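(* Let $q$ be an odd prime power and let $\mathcal{S}$ be an $(n-1)$-spread of $\mathrm{PG}(3n-1,q)$ containing three (distinct) normal elements contained in the same $(2n-1)$-dimensional subspace $\Pi_0$. Then there exist a spread set $\mathbf{M}_0$ containing $0$ and $I$, a semifield spread set $\mathbf{M}$, and a collineation $\varphi$ of $\mathrm{PG}(3n-1,q)$ with $\varphi(\Pi_0)=\{(x,y,0)_{\mathbb{F}_q}\}$ and $\varphi(\mathcal{S})=\mathcal{T}_3(\mathbf{M},\mathbf{M}_0)$. Furthermore, $\varphi$ maps the set of normal elements of $\mathcal{S}$ contained in $\Pi_0$ onto $\{(I,C,0): C\in\mathbf{M}_0\cap\mathcal{N}_r(\mathbf{M})\}\cup\{(0,I,0)\}$.
   Context: An $(n-1)$-spread of $\mathrm{PG}(N-1,q)$ is a set of $(n-1)$-dimensional subspaces partitioning the point set. An element $E$ of an $(n-1)$-spread $\mathcal{S}$ of $\mathrm{PG}(3n-1,q)$ is normal if for every $F\in\mathcal{S}\setminus\{E\}$ the $(2n-1)$-space $\langle E,F\rangle$ is partitioned by elements of $\mathcal{S}$. Coordinates: points of $\mathrm{PG}(3n-1,q)$ are $(x_1,x_2,x_3)_{\mathbb{F}_q}$, $x_i\in\mathbb{F}_q^n$ row vectors, not all zero, up to $\mathbb{F}_q^*$-scalars; for $n\times n$ matrices with $[A_1\ A_2\ A_3]$ of rank $n$, $(A_1,A_2,A_3)=\{(xA_1,xA_2,xA_3)_{\mathbb{F}_q}:x\neq0\}$; $I,0$ are the identity and zero matrices. A spread set is a set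 $\mathbf{M}$ of $q^n$ $n\times n$ matrices over $\mathbb{F}_q$ with $A-B$ nonsingular for distinct $A,B\in\mathbf{M}$. A semifield spread set is a spread set containing $0$ and $I$ that is closed under addition. For spread sets $\mathbf{M},\mathbf{M}_0$ containing $0$ and $I$, $\mathcal{T}_3(\mathbf{M},\mathbf{M}_0)=\{(A,B,I):A,B\in\mathbf{M}\}\cup\{(I,C,0):C\in\mathbf{M}_0\}\cup\{(0,I,0)\}$. For a spread set $\mathbf{M}$, $\mathcal{N}_r(\mathbf{M})=\{X\in\mathbf{M}: X=0 \text{ or } \mathbf{M}X=\mathbf{M}\}$, where $\mathbf{M}X=\{AX:A\in\mathbf{M}\}$. *)

theory Defs
  imports "HOL-Analysis.Analysis" "HOL-Library.Disjoint_Sets"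
begin

section \<open>Projective space over a field\<close>

text \<open>
  The projective space of \<open>'a^'k\<close> has projective dimension \<open>CARD('k) - 1\<close>. Its points are the
  one-dimensional vector subspaces (as sets of vectors); every other projective subspace is
  represented by its set of points.
\<close>

type_synonym ('a, 'k) pg_point = "('a, 'k) vec set"

definition proj_point :: "'a::field ^ 'k::finite \<Rightarrow> ('a, 'k) pg_point" where
  "proj_point v = vec.span {v}"

definition pg_points :: "('a::field, 'k::finite) pg_point set" where
  "pg_points = {proj_point v | v. v \<noteq> 0}"

definition points_of :: "('a::field ^ 'k::finite) set \<Rightarrow> ('a, 'k) pg_point set" where
  "points_of W = {proj_point v | v. v \<in> W \<and> v \<noteq> 0}"

text \<open>Here \<open>d\<close> is the projective dimension, one less than the vector space dimension.\<close>

definition proj_subspace :: "nat \<Rightarrow> ('a::field, 'k::finite) pg_point set \<Rightarrow> bool" where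
  "proj_subspace d X \<longleftrightarrow> (\<exists>W. vec.subspace W \<and> vec.dim W = d + 1 \<and> X = points_of W)"

definition proj_join ::
  "('a::field, 'k::finite) pg_point set \<Rightarrow> ('a, 'k) pg_point set \<Rightarrow> ('a, 'k) pg_point set" where
  "proj_join E F = points_of (vec.span (\<Union>E \<union> \<Union>F))"

definition collineation :: "(('a::field, 'k::finite) pg_point \<Rightarrow> ('a, 'k) pg_point) \<Rightarrow> bool" where
  "collineation \<phi> \<longleftrightarrow> bij_betw \<phi> pg_points pg_points \<and>
     (\<forall>L. L \<subseteq> pg_points \<longrightarrow> (proj_subspace 1 L \<longleftrightarrow> proj_subspace 1 (\<phi> ` L)))"

section \<open>Spreads and normal elements\<close>

definition is_spread :: "nat \<Rightarrow> ('a::field, 'k::finite) pg_point set set \<Rightarrow> bool" where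
  "is_spread d S \<longleftrightarrow> (\<forall>E\<in>S. proj_subspace d E) \<and> partition_on pg_points S"

definition normal_element ::
  "('a::field, 'k::finite) pg_point set set \<Rightarrow> ('a, 'k) pg_point set \<Rightarrow> bool" where
  "normal_element S E \<longleftrightarrow>
     E \<in> S \<and> (\<forall>F\<in>S - {E}. \<exists>T\<subseteq>S. partition_on (proj_join E F) T)"

section \<open>Block coordinates\<close>

text \<open>
  With \<open>n = CARD('n)\<close>, the space \<open>'a^('n + 'n + 'n)\<close> has dimension \<open>3n\<close>, and \<open>blocks x y z\<close> is the
  vector written \<open>(x, y, z)\<close> in coordinates.
\<close>

definition blocks ::
  "'a ^ 'n::finite \<Rightarrow> 'a ^ 'n \<Rightarrow> 'a ^ 'n \<Rightarrow> 'a ^ ('n + 'n + 'n)" where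
  "blocks x y z =
     (\<chi> i. case i of Inl j \<Rightarrow> x $ j | Inr (Inl j) \<Rightarrow> y $ j | Inr (Inr j) \<Rightarrow> z $ j)"

text \<open>
  The vectors \<open>x\<close> are row vectors. The set is an \<open>(n-1)\<close>-dimensional projective subspace only if
  the \<open>n \<times> 3n\<close> matrix \<open>[A B C]\<close> has rank \<open>n\<close>; in all uses below one of the blocks is the identity.
\<close>

definition mat_space ::
  "'a::field ^ 'n::finite ^ 'n \<Rightarrow> 'a ^ 'n ^ 'n \<Rightarrow> 'a ^ 'n ^ 'n \<Rightarrow> ('a, 'n + 'n + 'n) pg_point set" where
  "mat_space A B C = {proj_point (blocks (x v* A) (x v* B) (x v* C)) | x. x \<noteq> 0}"

section \<open>Spread sets\<close>

definition spread_set :: "('a::{field,finite} ^ 'n::finite ^ 'n) set \<Rightarrow> bool" where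
  "spread_set M \<longleftrightarrow> card M = CARD('a) ^ CARD('n) \<and>
     (\<forall>A\<in>M. \<forall>B\<in>M. A \<noteq> B \<longrightarrow> invertible (A - B))"

definition semifield_spread_set :: "('a::{field,finite} ^ 'n::finite ^ 'n) set \<Rightarrow> bool" where
  "semifield_spread_set M \<longleftrightarrow> spread_set M \<and> 0 \<in> M \<and> mat 1 \<in> M \<and>
     (\<forall>A\<in>M. \<forall>B\<in>M. A + B \<in> M)"

definition T3 :: "('a::field ^ 'n::finite ^ 'n) set \<Rightarrow> ('a ^ 'n ^ 'n) set \<Rightarrow>
    ('a, 'n + 'n + 'n) pg_point set set" where
  "T3 M M0 = {mat_space A B (mat 1) | A B. A \<in> M \<and> B \<in> M} \<union>
     {mat_space (mat 1) C 0 | C. C \<in> M0} \<union> {mat_space 0 (mat 1) 0}"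

definition right_nucleus :: "('a::field ^ 'n::finite ^ 'n) set \<Rightarrow> ('a ^ 'n ^ 'n) set" where
  "right_nucleus M = {X \<in> M. X = 0 \<or> (\<lambda>A. A ** X) ` M = M}"

end

theory Submission
  imports Defs
begin

text \<open>
  Choose coordinates in which the three normal elements are \<open>(0, I, 0)\<close>, \<open>(I, 0, 0)\<close> and \<open>(I, I, 0)\<close>
  and in which \<open>(0, 0, I)\<close> and \<open>(I, 0, I)\<close> belong to the spread. The elements off \<open>\<Pi>\<^sub>0\<close> are
  then of the form \<open>(A, B, I)\<close>, and there are \<open>q\<^sup>2\<^sup>n\<close> of them. Normality of \<open>(0, I, 0)\<close> and \<open>(I, 0, 0)\<close>
  makes the sets \<open>M\<^sub>1\<close> and \<open>M\<^sub>2\<close> of all \<open>A\<close> and of all \<open>B\<close> have nonsingular differences, so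
  each has at most \<open>q\<^sup>n\<close> members, and by counting the pairs \<open>(A, B)\<close> fill \<open>M\<^sub>1 \<times> M\<^sub>2\<close>. Normality of
  \<open>(I, C, 0)\<close> says that \<open>{B - A C}\<close> also has nonsingular differences; this set contains \<open>M\<^sub>2\<close>, hence
  equals it. For \<open>C = I\<close> this gives \<open>M\<^sub>1 = M\<^sub>2\<close> and additivity, and in general it says that \<open>C\<close>
  lies in the right nucleus.
\<close>

section \<open>Spreads of vector spaces\<close>

lemma proj_point_mem_points_of:
  assumes "vec.subspace W" "v \<noteq> 0"
  shows "proj_point v \<in> points_of W \<longleftrightarrow> v \<in> W"
proof
  assume "proj_point v \<in> points_of W"
  then obtain w where w: "w \<in> W" "vec.span {v} = vec.span {w}"
    by (auto simp: points_of_def proj_point_def)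
  have "vec.span {w} \<subseteq> W" using w(1) assms(1) by (intro vec.span_minimal) auto
  moreover have "v \<in> vec.span {v}" by (simp add: vec.span_base)
  ultimately show "v \<in> W" using w(2) by blast
qed (use assms in \<open>auto simp: points_of_def\<close>)

lemma points_of_subset_iff:
  assumes "vec.subspace V" "vec.subspace W"
  shows "points_of V \<subseteq> points_of W \<longleftrightarrow> V \<subseteq> W"
proof
  assume *: "points_of V \<subseteq> points_of W"
  show "V \<subseteq> W"
  proof
    fix v assume "v \<in> V"
    show "v \<in> W"
    proof (cases "v = 0")
      case False
      then have "proj_point v \<in> points_of V" using \<open>v \<in> V\<close> by (auto simp: points_of_def)
      with * False show ?thesis using proj_point_mem_points_of[OF assms(2)] by blast
    qed (use assms in \<open>simp add: vec.subspace_0\<close>)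
  qed
qed (auto simp: points_of_def)

lemma points_of_eq_iff:
  assumes "vec.subspace V" "vec.subspace W"
  shows "points_of V = points_of W \<longleftrightarrow> V = W"
  using points_of_subset_iff[OF assms] points_of_subset_iff[OF assms(2,1)] by blast

text \<open>The union of the points of a subspace is the subspace itself, except that it is empty
  for the zero subspace. Spans do not notice the zero vector, so joins of point sets reduce to sums
  of subspaces.\<close>

lemma span_Union_points_of:
  assumes "vec.subspace V" "vec.subspace W"
  shows "vec.span (\<Union>(points_of V) \<union> \<Union>(points_of W)) = vec.span (V \<union> W)"
proof -
  have *: "U - {0} \<subseteq> \<Union>(points_of U) \<and> \<Union>(points_of U) \<subseteq> U" if "vec.subspace U" for U :: "('a^'b) set"
  proof (intro conjI subsetI)
    fix v assume "v \<in> U - {0}"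
    then have "vec.span {v} \<in> points_of U" by (auto simp: points_of_def proj_point_def)
    then show "v \<in> \<Union>(points_of U)" using vec.span_base[of v "{v}"] by blast
  next
    fix v assume "v \<in> \<Union>(points_of U)"
    then obtain w where "w \<in> U" "v \<in> vec.span {w}" by (auto simp: points_of_def proj_point_def)
    then show "v \<in> U" using vec.span_minimal[of "{w}" U] that by blast
  qed
  have "vec.span (V \<union> W) = vec.span ((V \<union> W) - {0})" by (simp add: vec.span_delete_0)
  also have "\<dots> \<subseteq> vec.span (\<Union>(points_of V) \<union> \<Union>(points_of W))"
    using *[OF assms(1)] *[OF assms(2)] by (intro vec.span_mono) auto
  finally have "vec.span (V \<union> W) \<subseteq> vec.span (\<Union>(points_of V) \<union> \<Union>(points_of W))" .
  moreover have "vec.span (\<Union>(points_of V) \<union> \<Union>(points_of W)) \<subseteq> vec.span (V \<union> W)"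
    using *[OF assms(1)] *[OF assms(2)] by (intro vec.span_mono) blast
  ultimately show ?thesis by blast
qed

lemma pg_points_eq: "pg_points = points_of UNIV"
  by (auto simp: pg_points_def points_of_def)

section \<open>Spreads and normality in terms of vector subspaces\<close>

definition vector_spread :: "nat \<Rightarrow> ('a::field ^ 'k::finite) set set \<Rightarrow> bool" where
  "vector_spread d \<Omega> \<longleftrightarrow> (\<forall>W\<in>\<Omega>. vec.subspace W \<and> vec.dim W = d) \<and>
     (\<forall>v. v \<noteq> 0 \<longrightarrow> (\<exists>!W. W \<in> \<Omega> \<and> v \<in> W))"

text \<open>A sum of two elements is partitioned by spread elements exactly when each spread element
  that meets it nontrivially lies inside it. This form avoids choosing the partitioning
  subfamily.\<close>

definition vector_normal :: "('a::field ^ 'k::finite) set set \<Rightarrow> ('a ^ 'k) set \<Rightarrow> bool" where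
  "vector_normal \<Omega> E \<longleftrightarrow> E \<in> \<Omega> \<and> (\<forall>F\<in>\<Omega> - {E}. \<forall>G\<in>\<Omega>.
     G \<inter> vec.span (E \<union> F) \<subseteq> {0} \<or> G \<subseteq> vec.span (E \<union> F))"

lemma vector_spread_subspace: "vector_spread d \<Omega> \<Longrightarrow> W \<in> \<Omega> \<Longrightarrow> vec.subspace W"
  by (simp add: vector_spread_def)

lemma vector_spread_unique:
  "vector_spread d \<Omega> \<Longrightarrow> V \<in> \<Omega> \<Longrightarrow> W \<in> \<Omega> \<Longrightarrow> v \<in> V \<Longrightarrow> v \<in> W \<Longrightarrow> v \<noteq> 0 \<Longrightarrow> V = W"
  by (auto simp: vector_spread_def)

lemma vector_spread_cover:
  "vector_spread d \<Omega> \<Longrightarrow> v \<noteq> 0 \<Longrightarrow> \<exists>W\<in>\<Omega>. v \<in> W"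
  unfolding vector_spread_def by blast

lemma dim_pos_nonzero:
  fixes W :: "('a::field ^ 'b::finite) set"
  assumes "vec.dim W > 0"
  shows "\<exists>v\<in>W. v \<noteq> 0"
proof (rule ccontr)
  assume "\<not> ?thesis"
  then have "W \<subseteq> {0}" by auto
  then have "vec.dim W = 0" by (simp only: vec.dim_eq_0)
  then show False using assms by linarith
qed

text \<open>A subspace is determined by its points, so the spread lifts to subspaces;
  \<open>d + 1\<close> is the linear dimension that belongs to projective dimension
  \<open>d\<close>.\<close>

lemma is_spread_imp_vector_spread:
  assumes "is_spread d S"
  obtains \<Omega> where "vector_spread (d + 1) \<Omega>" "S = points_of ` \<Omega>"
proof
  let ?\<Omega> = "{W. vec.subspace W \<and> vec.dim W = d + 1 \<and> points_of W \<in> S}"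
  show "S = points_of ` ?\<Omega>"
    using assms by (auto simp: is_spread_def proj_subspace_def)
  have part: "partition_on (points_of UNIV) S" using assms by (simp add: is_spread_def pg_points_eq)
  show "vector_spread (d + 1) ?\<Omega>"
    unfolding vector_spread_def
  proof (intro conjI allI impI ballI)
    fix v :: "'a^'b" assume v: "v \<noteq> 0"
    then have "proj_point v \<in> points_of UNIV" by (auto simp: points_of_def)
    then obtain E where E: "E \<in> S" "proj_point v \<in> E"
      using partition_onD1[OF part] by blast
    then obtain W where W: "W \<in> ?\<Omega>" "E = points_of W" using \<open>S = points_of ` ?\<Omega>\<close> by auto
    show "\<exists>!W. W \<in> ?\<Omega> \<and> v \<in> W"
    proof (rule ex1I[of _ W])
      show "W \<in> ?\<Omega> \<and> v \<in> W" using W E proj_point_mem_points_of[of W v] v by auto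
    next
      fix U assume U: "U \<in> ?\<Omega> \<and> v \<in> U"
      then have "proj_point v \<in> points_of U" using v by (auto simp: points_of_def)
      then have "points_of U = E" using E U partition_onD2[OF part]
        by (auto simp: disjoint_def)
      then show "U = W" using W U points_of_eq_iff[of U W] by auto
    qed
  qed auto
qed

lemma normal_element_points_of_iff:
  assumes \<Omega>: "vector_spread d \<Omega>" and "d > 0" and E: "E \<in> \<Omega>"
  shows "normal_element (points_of ` \<Omega>) (points_of E) \<longleftrightarrow> vector_normal \<Omega> E"
proof -
  note sub = vector_spread_subspace[OF \<Omega>]
  \<comment> \<open>A spread element sharing a nonzero vector with \<open>J\<close> shares a point
    with a member of \<open>T\<close>, hence is that member. For the converse, the elements
    contained in \<open>J\<close> serve as the blocks.\<close>
  have key: "(\<exists>T\<subseteq>points_of ` \<Omega>. partition_on (points_of J) T) \<longleftrightarrow>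
      (\<forall>G\<in>\<Omega>. G \<inter> J \<subseteq> {0} \<or> G \<subseteq> J)" if J: "vec.subspace J" for J
  proof
    assume "\<exists>T\<subseteq>points_of ` \<Omega>. partition_on (points_of J) T"
    then obtain T where T: "T \<subseteq> points_of ` \<Omega>" "partition_on (points_of J) T" by blast
    show "\<forall>G\<in>\<Omega>. G \<inter> J \<subseteq> {0} \<or> G \<subseteq> J"
    proof (intro ballI disjCI)
      fix G assume G: "G \<in> \<Omega>" and "\<not> G \<subseteq> J"
      show "G \<inter> J \<subseteq> {0}"
      proof (rule ccontr)
        assume "\<not> ?thesis"
        then obtain v where v: "v \<in> G" "v \<in> J" "v \<noteq> 0" by auto
        then have "proj_point v \<in> \<Union>T"
          using partition_onD1[OF T(2)] by (auto simp: points_of_def)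
        then obtain H where H: "H \<in> \<Omega>" "proj_point v \<in> points_of H" "points_of H \<in> T"
          using T(1) by blast
        then have "v \<in> H" using proj_point_mem_points_of sub v(3) by blast
        then have "H = G" using vector_spread_unique[OF \<Omega>] H G v by blast
        then have "points_of G \<subseteq> points_of J" using H partition_onD1[OF T(2)] by blast
        then show False using \<open>\<not> G \<subseteq> J\<close> points_of_subset_iff sub G J by blast
      qed
    qed
  next
    assume *: "\<forall>G\<in>\<Omega>. G \<inter> J \<subseteq> {0} \<or> G \<subseteq> J"
    let ?T = "points_of ` {G\<in>\<Omega>. G \<subseteq> J}"
    have "partition_on (points_of J) ?T"
    proof (rule partition_onI)
      show "\<Union>?T = points_of J"
      proof
        show "points_of J \<subseteq> \<Union>?T"
        proof
          fix p assume "p \<in> points_of J"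
          then obtain v where v: "v \<in> J" "v \<noteq> 0" "p = proj_point v" by (auto simp: points_of_def)
          then obtain G where G: "G \<in> \<Omega>" "v \<in> G" using vector_spread_cover[OF \<Omega>] by blast
          with * v have "G \<subseteq> J" by blast
          moreover have "p \<in> points_of G" using v G by (auto simp: points_of_def)
          ultimately show "p \<in> \<Union>?T" using G by blast
        qed
      qed (auto simp: points_of_def)
    next
      fix p q assume pq: "p \<in> ?T" "q \<in> ?T" "p \<noteq> q"
      then obtain G H where GH: "G \<in> \<Omega>" "H \<in> \<Omega>" "p = points_of G" "q = points_of H" by auto
      show "disjnt p q"
      proof (rule ccontr)
        assume "\<not> disjnt p q"
        then obtain v where v: "v \<noteq> 0" "v \<in> G" "proj_point v \<in> points_of H"
          using GH by (auto simp: disjnt_def points_of_def)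
        then have "v \<in> H" using proj_point_mem_points_of sub GH by blast
        then show False using vector_spread_unique[OF \<Omega>] GH v pq by blast
      qed
    next
      \<comment> \<open>Blocks of a partition must be nonempty; this rests on
        \<open>d > 0\<close>.\<close>
      show "{} \<notin> ?T"
      proof
        assume "{} \<in> ?T"
        then obtain G where G: "G \<in> \<Omega>" "points_of G = {}" by auto
        then show False using dim_pos_nonzero[of G] \<Omega> \<open>d > 0\<close>
          by (auto simp: vector_spread_def points_of_def)
      qed
    qed
    moreover have "?T \<subseteq> points_of ` \<Omega>" by blast
    ultimately show "\<exists>T\<subseteq>points_of ` \<Omega>. partition_on (points_of J) T" by blast
  qed
  have "points_of ` \<Omega> - {points_of E} = points_of ` (\<Omega> - {E})"
    using points_of_eq_iff sub E by blast
  then show ?thesis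
    using E key[OF vec.subspace_span]
    by (simp add: normal_element_def vector_normal_def proj_join_def span_Union_points_of sub)
qed

section \<open>Linear maps and spread sets\<close>

abbreviation vec_linear :: "('a::field ^ 'k::finite \<Rightarrow> 'a ^ 'l::finite) \<Rightarrow> bool" where
  "vec_linear \<equiv> Vector_Spaces.linear (*s) (*s)"

lemma vec_linearI:
  assumes "\<And>x y. f (x + y) = f x + f y" "\<And>c x. f (c *s x) = c *s f x"
  shows "vec_linear f"
  by unfold_locales (use assms in \<open>vector algebra_simps\<close>)+

lemma vec_linear_simps:
  assumes "vec_linear f"
  shows "f (x + y) = f x + f y" "f (c *s x) = c *s f x" "f 0 = 0" "f (x - y) = f x - f y"
    "f (- x) = - f x"
proof -
  interpret f: Vector_Spaces.linear "(*s)" "(*s)" f by fact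
  show "f (x + y) = f x + f y" "f (c *s x) = c *s f x" "f 0 = 0" "f (x - y) = f x - f y"
    "f (- x) = - f x"
    by (simp_all add: f.add f.scale f.zero f.diff f.neg)
qed

lemma vec_linear_subspace_image:
  "vec_linear f \<Longrightarrow> vec.subspace W \<Longrightarrow> vec.subspace (f ` W)"
  by (rule vec.linear_subspace_image)

lemma span_image_vec_linear: "vec_linear f \<Longrightarrow> vec.span (f ` X) = f ` vec.span X"
  by (rule vec.linear_span_image)

lemma dim_image_vec_linear:
  "vec_linear f \<Longrightarrow> inj f \<Longrightarrow> vec.dim (f ` W) = vec.dim W"
  by (intro vec.dim_image_eq) (auto intro: inj_on_subset)

lemma vec_linear_inv:
  assumes "vec_linear f" "bij f"
  shows "vec_linear (inv f)"
proof (rule vec_linearI)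
  have inv: "inv f (f x) = x" "f (inv f y) = y" for x y
    using assms(2) by (simp_all add: bij_is_inj bij_is_surj surj_f_inv_f)
  have eqI: "x = y" if "f x = f y" for x y
    using that assms(2) by (metis inv(1))
  fix x y c
  show "inv f (x + y) = inv f x + inv f y"
    by (rule eqI) (simp add: inv vec_linear_simps[OF assms(1)])
  show "inv f (c *s x) = c *s inv f x"
    by (rule eqI) (simp add: inv vec_linear_simps[OF assms(1)])
qed

lemma image_proj_point: "vec_linear L \<Longrightarrow> L ` proj_point v = proj_point (L v)"
  by (simp add: proj_point_def flip: span_image_vec_linear)

lemma image_points_of:
  assumes "vec_linear L" "inj L"
  shows "(`) L ` points_of W = points_of (L ` W)"
proof -
  have "L v = 0 \<longleftrightarrow> v = 0" for v
    using assms vec_linear_simps(3)[OF assms(1)] by (metis injD)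
  then show ?thesis
    using image_proj_point[OF assms(1)] by (fastforce simp: points_of_def)
qed

lemma collineation_image:
  fixes L :: "'a::field ^ 'k::finite \<Rightarrow> 'a ^ 'k"
  assumes L: "vec_linear L" "bij L"
  shows "collineation ((`) L)"
  unfolding collineation_def
proof (intro conjI allI impI)
  have inj: "inj ((`) L)" using bij_is_inj[OF L(2)] by (meson injI inj_image_eq_iff)
  have "(`) L ` pg_points = pg_points"
    using L by (simp add: pg_points_eq image_points_of bij_is_inj bij_is_surj)
  with inj show "bij_betw ((`) L) pg_points pg_points"
    unfolding bij_betw_def by (metis inj_on_subset subset_UNIV)
  have dir: "proj_subspace 1 ((`) K ` X)" if "vec_linear K" "inj K" "proj_subspace 1 X"
    for X and K :: "'a ^ 'k \<Rightarrow> 'a ^ 'k"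
  proof -
    obtain W where W: "vec.subspace W" "vec.dim W = 1 + 1" "X = points_of W"
      using \<open>proj_subspace 1 X\<close> unfolding proj_subspace_def by blast
    have "vec.subspace (K ` W)" "vec.dim (K ` W) = 1 + 1" "(`) K ` X = points_of (K ` W)"
      using W that by (simp_all only: vec_linear_subspace_image dim_image_vec_linear image_points_of)
    then show ?thesis unfolding proj_subspace_def by blast
  qed
  fix X :: "('a, 'k) pg_point set"
  \<comment> \<open>Lines are reflected as well as preserved, because \<open>dir\<close> also
    applies to the inverse of \<open>L\<close>.\<close>
  have "(`) (inv L) ` (`) L ` X = X"
    using bij_is_inj[OF L(2)] by (simp add: image_image)
  then show "proj_subspace 1 X \<longleftrightarrow> proj_subspace 1 ((`) L ` X)"
    using dir[OF L(1)] dir[OF vec_linear_inv[OF L], of "(`) L ` X"] L(2)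
    by (metis bij_imp_bij_inv bij_is_inj)
qed

lemma vector_spread_image:
  assumes L: "vec_linear L" "bij L" and \<Omega>: "vector_spread d \<Omega>"
  shows "vector_spread d ((`) L ` \<Omega>)"
  unfolding vector_spread_def
proof (intro conjI allI impI ballI)
  fix v :: "'a^'c" assume "v \<noteq> 0"
  moreover have "L (inv L v) = v" using L(2) by (simp add: bij_is_surj surj_f_inv_f)
  ultimately have "inv L v \<noteq> 0" using vec_linear_simps(3)[OF L(1)] by auto
  then obtain W where W: "W \<in> \<Omega>" "inv L v \<in> W" "\<And>U. U \<in> \<Omega> \<Longrightarrow> inv L v \<in> U \<Longrightarrow> U = W"
    using \<Omega> unfolding vector_spread_def by blast
  have mem: "v \<in> L ` U \<longleftrightarrow> inv L v \<in> U" for U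
    using inj_image_mem_iff[OF bij_is_inj[OF L(2)], of "inv L v" U] \<open>L (inv L v) = v\<close> by simp
  show "\<exists>!W. W \<in> (`) L ` \<Omega> \<and> v \<in> W"
  proof (rule ex1I[of _ "L ` W"])
    show "L ` W \<in> (`) L ` \<Omega> \<and> v \<in> L ` W" using W(1,2) mem by simp
  next
    fix U assume U: "U \<in> (`) L ` \<Omega> \<and> v \<in> U"
    then obtain U' where "U' \<in> \<Omega>" "U = L ` U'" by blast
    then show "U = L ` W" using U W(3) mem by simp
  qed
qed (use assms in \<open>auto simp: vector_spread_def vec_linear_subspace_image dim_image_vec_linear bij_is_inj\<close>)

text \<open>Normality is phrased with spans, intersections and inclusions, all of which a linear
  bijection respects in both directions.\<close>

lemma vector_normal_image_iff:
  assumes L: "vec_linear L" "bij L"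
  shows "vector_normal ((`) L ` \<Omega>) (L ` E) \<longleftrightarrow> vector_normal \<Omega> E"
proof -
  have inj: "inj L" using L by (simp add: bij_is_inj)
  have L0: "L x = 0 \<longleftrightarrow> x = 0" for x using inj vec_linear_simps(3)[OF L(1)] by (metis injD)
  have "(`) L ` \<Omega> - {L ` E} = (`) L ` (\<Omega> - {E})" 
    using inj by (auto simp: inj_image_eq_iff)
  moreover have "L ` E \<in> (`) L ` \<Omega> \<longleftrightarrow> E \<in> \<Omega>" using inj by (auto simp: inj_image_eq_iff)
  moreover have "L ` G \<inter> vec.span (L ` E \<union> L ` F) \<subseteq> {0} \<longleftrightarrow> G \<inter> vec.span (E \<union> F) \<subseteq> {0}"
    "L ` G \<subseteq> vec.span (L ` E \<union> L ` F) \<longleftrightarrow> G \<subseteq> vec.span (E \<union> F)" for F G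
    using inj by (auto simp: L0 inj_image_subset_iff span_image_vec_linear[OF L(1)]
       simp flip: image_Un image_Int)
  ultimately show ?thesis by (simp add: vector_normal_def)
qed

section \<open>Parametrized subspaces and direct sums over a finite field\<close>

lemma card_vec_subspace:
  fixes W :: "('a::{field,finite} ^ 'k::finite) set"
  assumes W: "vec.subspace W" "vec.dim W = CARD('n)"
  obtains f :: "'a ^ 'n::finite \<Rightarrow> 'a ^ 'k" where "vec_linear f" "inj f" "range f = W"
proof -
  have "vec.dim (UNIV :: ('a ^ 'n) set) = CARD('n)" by (rule vec_dim_card)
  then have "\<exists>f :: 'a ^ 'n \<Rightarrow> 'a ^ 'k. vec_linear f \<and> f ` UNIV = W \<and> inj_on f UNIV"
    using W by (intro vec.subspace_isomorphism) auto
  then show ?thesis using that by blast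
qed

lemma card_subspace:
  fixes W :: "('a::{field,finite} ^ 'k::finite) set"
  assumes "vec.subspace W" "vec.dim W = CARD('n::finite)"
  shows "card W = CARD('a ^ 'n)"
  using card_vec_subspace[OF assms] by (metis card_image)

lemma span_Un_subspaces:
  assumes "vec.subspace U" "vec.subspace W"
  shows "vec.span (U \<union> W) = {u + w | u w. u \<in> U \<and> w \<in> W}"
  using assms by (simp add: vec.span_Un vec.span_eq_iff[THEN iffD2])

lemma card_span_Un:
  fixes U W :: "('a::{field,finite} ^ 'k::finite) set"
  assumes "vec.subspace U" "vec.subspace W" "U \<inter> W \<subseteq> {0}"
  shows "card (vec.span (U \<union> W)) = card U * card W"
proof -
  have "inj_on (\<lambda>(u, w). u + w) (U \<times> W)"
  proof (rule inj_onI, clarify)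
    fix u w u' w' assume *: "u \<in> U" "w \<in> W" "u' \<in> U" "w' \<in> W" "u + w = u' + w'"
    then have eq: "u - u' = w' - w" by (simp add: algebra_simps)
    have "u - u' \<in> U" "w' - w \<in> W" using * assms by (auto intro: vec.subspace_diff)
    then have "u - u' = 0" using eq assms(3) by auto
    then show "u = u' \<and> w = w'" using eq by simp
  qed
  moreover have "vec.span (U \<union> W) = (\<lambda>(u, w). u + w) ` (U \<times> W)"
    by (auto simp: span_Un_subspaces assms)
  ultimately show ?thesis by (simp add: card_image card_cartesian_product)
qed

text \<open>The sum is direct, so it has \<open>card U * card W\<close> elements; being contained in
  \<open>P\<close>, it fills \<open>P\<close>. Counting stands in for a dimension formula.\<close>

lemma span_Un_eqI:
  fixes U W :: "('a::{field,finite} ^ 'k::finite) set"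
  assumes "vec.subspace U" "vec.subspace W" "U \<inter> W \<subseteq> {0}"
    and "vec.subspace P" "U \<subseteq> P" "W \<subseteq> P" "card P = card U * card W"
  shows "vec.span (U \<union> W) = P"
proof (rule card_subset_eq)
  show "vec.span (U \<union> W) \<subseteq> P" using assms by (intro vec.span_minimal) auto
qed (simp_all add: assms card_span_Un)

text \<open>The subspace \<open>range a\<close> is complementary to \<open>U\<close> in \<open>U + W\<close>, and \<open>W\<close> is the graph of an
  isomorphism between the two.\<close>

lemma graph_map:
  fixes a :: "'a::{field,finite} ^ 'n::finite \<Rightarrow> 'a ^ 'k::finite"
  assumes a: "vec_linear a" "inj a"
    and U: "vec.subspace U" "card U = CARD('a ^ 'n)"
    and W: "vec.subspace W" "card W = CARD('a ^ 'n)"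
    and triv: "range a \<inter> U \<subseteq> {0}" "U \<inter> W \<subseteq> {0}" "range a \<inter> W \<subseteq> {0}"
    and sub: "W \<subseteq> vec.span (range a \<union> U)"
  obtains b where "vec_linear b" "inj b" "range b = U" "range (\<lambda>x. a x + b x) = W"
proof -
  note lin = vec_linear_simps[OF a(1)]
  have ra: "vec.subspace (range a)" "card (range a) = CARD('a ^ 'n)"
    using a by (auto simp: vec_linear_subspace_image card_image)
  \<comment> \<open>\<open>W\<close> lies in the sum of \<open>range a\<close> and \<open>U\<close>,
    and both sums are direct with equally many elements.\<close>
  have "vec.span (U \<union> W) = vec.span (range a \<union> U)"
    using U W triv ra sub
    by (intro span_Un_eqI) (auto simp: card_span_Un intro: vec.span_base)
  then have "a x \<in> vec.span (U \<union> W)" for x by (auto intro: vec.span_base)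
  then have "\<exists>u\<in>U. \<exists>w\<in>W. a x = u + w" for x using span_Un_subspaces[OF U(1) W(1)] by blast
  then have "\<exists>y\<in>U. a x + y \<in> W" for x
    by (metis add_diff_cancel_left' diff_add_cancel uminus_add_conv_diff add.commute vec.subspace_neg[OF U(1)])
  then obtain b where b: "\<And>x. b x \<in> U" "\<And>x. a x + b x \<in> W" by metis
  \<comment> \<open>Two candidates for \<open>b x\<close> differ by an element of
    \<open>U \<inter> W\<close>, which is zero. Linearity of \<open>b\<close> follows from this
    uniqueness.\<close>
  have uniq: "y = b x" if "y \<in> U" "a x + y \<in> W" for x y
  proof -
    have "y - b x \<in> U" using that b U(1) by (auto intro: vec.subspace_diff)
    moreover have "(a x + y) - (a x + b x) \<in> W" by (intro vec.subspace_diff W(1) that b)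
    ultimately show ?thesis using triv(2) by auto
  qed
  have b_lin: "vec_linear b"
  proof (rule vec_linearI)
    fix x y c
    have "(a x + b x) + (a y + b y) \<in> W" by (intro vec.subspace_add W(1) b)
    then show "b (x + y) = b x + b y"
      by (intro uniq[symmetric] vec.subspace_add[OF U(1)] b) (simp add: lin algebra_simps)
    have "c *s (a x + b x) \<in> W" by (intro vec.subspace_scale W(1) b)
    then show "b (c *s x) = c *s b x"
      by (intro uniq[symmetric] vec.subspace_scale[OF U(1)] b) (simp add: lin vec.scale_right_distrib)
  qed
  note blin = vec_linear_simps[OF b_lin]
  have ker_a: "x = 0" if "a x = 0" for x using that a(2) lin(3) by (metis injD)
  have "inj b"
  proof (rule injI)
    fix x y assume "b x = b y"
    then have "b (x - y) = 0" by (simp add: blin)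
    then have "a (x - y) \<in> W" using b(2)[of "x - y"] by simp
    then have "a (x - y) = 0" using triv(3) by blast
    then show "x = y" using ker_a[of "x - y"] by simp
  qed
  moreover have "inj (\<lambda>x. a x + b x)"
  proof (rule injI)
    fix x y assume "a x + b x = a y + b y"
    then have "a (x - y) = b (y - x)" by (simp add: blin lin algebra_simps)
    then have "a (x - y) \<in> U" using b(1) by simp
    then have "a (x - y) = 0" using triv(1) by blast
    then show "x = y" using ker_a[of "x - y"] by simp
  qed
  ultimately have "inj b" "card (range b) = card U" "card (range (\<lambda>x. a x + b x)) = card W"
    using U W by (simp_all add: card_image)
  moreover have "range b \<subseteq> U" "range (\<lambda>x. a x + b x) \<subseteq> W" using b by auto
  ultimately have "range b = U" "range (\<lambda>x. a x + b x) = W" by (simp_all add: card_subset_eq)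
  then show ?thesis by (rule that[OF b_lin \<open>inj b\<close>])
qed

text \<open>On \<open>W\<close> the map \<open>p\<close> is injective between spaces of equal finite
  size, hence invertible, and \<open>h\<close> is its inverse. Applied to a block projection, it
  gives a parametrization of \<open>W\<close> in which that block is the identity.\<close>

lemma linear_section:
  fixes W :: "('a::{field,finite} ^ 'k::finite) set" and p :: "'a ^ 'k \<Rightarrow> 'a ^ 'n::finite"
  assumes W: "vec.subspace W" "vec.dim W = CARD('n)" and p: "vec_linear p"
    and ker: "\<And>w. w \<in> W \<Longrightarrow> p w = 0 \<Longrightarrow> w = 0"
  obtains h where "vec_linear h" "range h = W" "\<And>x. p (h x) = x"
proof -
  obtain f :: "'a ^ 'n \<Rightarrow> 'a ^ 'k" where f: "vec_linear f" "inj f" "range f = W"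
    using card_vec_subspace[OF W] .
  have lin: "vec_linear (p \<circ> f)" using Vector_Spaces.linear_compose[OF f(1) p] .
  have "inj (p \<circ> f)"
  proof (rule injI)
    fix x y assume "(p \<circ> f) x = (p \<circ> f) y"
    then have "p (f (x - y)) = 0" using vec_linear_simps[OF lin] by simp
    then have "f (x - y) = 0" using ker f(3) by blast
    then show "x = y" using vec_linear_simps[OF f(1)] f(2) by (simp add: injD)
  qed
  then have bij: "bij (p \<circ> f)" unfolding bij_def by (metis finite finite_UNIV_inj_surj)
  let ?h = "f \<circ> inv (p \<circ> f)"
  show ?thesis
  proof
    show "vec_linear ?h"
      using Vector_Spaces.linear_compose[OF vec_linear_inv[OF lin bij] f(1)] .
    show "range ?h = W"
      using f(3) bij_imp_bij_inv[OF bij] by (metis bij_is_surj image_comp)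
    show "p (?h x) = x" for x
      using surj_f_inv_f[OF bij_is_surj[OF bij], of x] by simp
  qed
qed

section \<open>Matrices acting on row vectors\<close>

lemma linear_eq_vector_matrix:
  fixes f :: "'a::field ^ 'n::finite \<Rightarrow> 'a ^ 'm::finite"
  assumes "vec_linear f"
  obtains A where "\<And>x. f x = x v* A"
proof
  \<comment> \<open>The transpose appears because \<open>matrix f\<close> acts on column
    vectors.\<close>
  show "f x = x v* transpose (matrix f)" for x
    using matrix_works[OF assms] by simp
qed

lemma matrix_eq_vector_matrix:
  fixes A B :: "'a::field ^ 'n::finite ^ 'm::finite"
  assumes "\<And>x. x v* A = x v* B"
  shows "A = B"
proof -
  have "transpose A = transpose B" unfolding matrix_eq using assms by simp
  then show ?thesis by (metis transpose_transpose)
qed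

lemma invertible_iff_vector_matrix:
  fixes A :: "'a::field ^ 'n::finite ^ 'n"
  shows "invertible A \<longleftrightarrow> (\<forall>x. x v* A = 0 \<longrightarrow> x = 0)"
  using matrix_left_invertible_ker[of "transpose A"]
  by (simp add: invertible_right_inverse left_invertible_transpose)

text \<open>A difference is nonsingular when it kills no nonzero row vector, that is, when the two
  matrices agree at no nonzero \<open>x\<close>. Separation properties are proved in this
  form.\<close>

lemma spread_set_iff:
  "spread_set M \<longleftrightarrow> card M = CARD('a) ^ CARD('n) \<and>
     (\<forall>A\<in>M. \<forall>B\<in>M. \<forall>x. x v* A = x v* B \<longrightarrow> x = 0 \<or> A = B)"
  for M :: "('a::{field,finite} ^ 'n::finite ^ 'n) set"
  unfolding spread_set_def invertible_iff_vector_matrix vector_matrix_mult_diff_rdistrib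
  by auto

lemma vec_nonzero_exists: "\<exists>x :: 'a::field ^ 'n::finite. x \<noteq> 0"
proof
  show "(\<chi> i. 1) \<noteq> (0 :: 'a ^ 'n)" by (simp add: vec_eq_iff)
qed

text \<open>Evaluation at one fixed nonzero vector is injective on \<open>N\<close>.\<close>

lemma card_separated_le:
  fixes N :: "('a::{field,finite} ^ 'n::finite ^ 'n) set"
  assumes "\<And>A B x. A \<in> N \<Longrightarrow> B \<in> N \<Longrightarrow> x v* A = x v* B \<Longrightarrow> x \<noteq> 0 \<Longrightarrow> A = B"
  shows "card N \<le> CARD('a ^ 'n)"
proof -
  obtain x :: "'a ^ 'n" where "x \<noteq> 0" using vec_nonzero_exists by blast
  then have "inj_on (\<lambda>A. x v* A) N" using assms by (auto intro: inj_onI)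
  then show ?thesis by (rule card_inj_on_le) auto
qed

section \<open>Block coordinates\<close>

lemma blocks_eq_iff [simp]:
  "blocks x y z = blocks x' y' z' \<longleftrightarrow> x = x' \<and> y = y' \<and> z = z'"
  by (auto simp: blocks_def vec_eq_iff all_conj_distrib split: sum.splits)

lemma blocks_zero: "blocks 0 0 0 = 0"
  by (auto simp: blocks_def vec_eq_iff split: sum.splits)

lemma blocks_eq_0_iff [simp]: "blocks x y z = 0 \<longleftrightarrow> x = 0 \<and> y = 0 \<and> z = 0"
  using blocks_eq_iff[of x y z 0 0 0] by (simp only: blocks_zero)

lemma blocks_add: "blocks x y z + blocks x' y' z' = blocks (x + x') (y + y') (z + z')"
  by (auto simp: blocks_def vec_eq_iff split: sum.splits)

lemma blocks_scale: "c *s blocks x y z = blocks (c *s x) (c *s y) (c *s z)"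
  by (auto simp: blocks_def vec_eq_iff split: sum.splits)

definition block1 :: "'a ^ ('n::finite + 'n + 'n) \<Rightarrow> 'a ^ 'n" where
  "block1 v = (\<chi> j. v $ Inl j)"

definition block2 :: "'a ^ ('n::finite + 'n + 'n) \<Rightarrow> 'a ^ 'n" where
  "block2 v = (\<chi> j. v $ Inr (Inl j))"

definition block3 :: "'a ^ ('n::finite + 'n + 'n) \<Rightarrow> 'a ^ 'n" where
  "block3 v = (\<chi> j. v $ Inr (Inr j))"

lemma block_blocks [simp]:
  "block1 (blocks x y z) = x" "block2 (blocks x y z) = y" "block3 (blocks x y z) = z"
  by (simp_all add: block1_def block2_def block3_def blocks_def)

lemma blocks_collapse: "blocks (block1 v) (block2 v) (block3 v) = v"
  by (auto simp: blocks_def block1_def block2_def block3_def vec_eq_iff split: sum.splits)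

lemma blocks_cases: obtains x y z where "v = blocks x y z"
  using blocks_collapse by metis

lemma block_linear: "vec_linear block1" "vec_linear block2" "vec_linear block3"
  by (rule vec_linearI; simp add: block1_def block2_def block3_def vec_eq_iff)+

lemma linear_eq_blocks:
  fixes h :: "'a::field ^ 'n::finite \<Rightarrow> 'a ^ ('n + 'n + 'n)"
  assumes "vec_linear h"
  obtains A B C where "\<And>x. h x = blocks (x v* A) (x v* B) (x v* C)"
proof -
  note comp = Vector_Spaces.linear_compose[OF assms]
  obtain A B C where "\<And>x. (block1 \<circ> h) x = x v* A" "\<And>x. (block2 \<circ> h) x = x v* B"
      "\<And>x. (block3 \<circ> h) x = x v* C"
    using linear_eq_vector_matrix[OF comp[OF block_linear(1)]]
      linear_eq_vector_matrix[OF comp[OF block_linear(2)]]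
      linear_eq_vector_matrix[OF comp[OF block_linear(3)]] by metis
  then show ?thesis using that blocks_collapse[of "h _"] by (metis comp_apply)
qed

text \<open>The vector space counterpart of \<open>mat_space\<close>; the zero vector is
  included.\<close>

definition block_space ::
  "'a::field ^ 'n::finite ^ 'n \<Rightarrow> 'a ^ 'n ^ 'n \<Rightarrow> 'a ^ 'n ^ 'n \<Rightarrow> ('a ^ ('n + 'n + 'n)) set" where
  "block_space A B C = range (\<lambda>x. blocks (x v* A) (x v* B) (x v* C))"

lemma mem_block_space:
  "blocks x y z \<in> block_space A B C \<longleftrightarrow> (\<exists>u. x = u v* A \<and> y = u v* B \<and> z = u v* C)"
  by (auto simp: block_space_def)

lemma blocks_in_block_space [simp]:
  "blocks x y z \<in> block_space A B (mat 1) \<longleftrightarrow> x = z v* A \<and> y = z v* B"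
  "blocks x y z \<in> block_space (mat 1) C 0 \<longleftrightarrow> y = x v* C \<and> z = 0"
  "blocks x y z \<in> block_space 0 (mat 1) 0 \<longleftrightarrow> x = 0 \<and> z = 0"
  by (auto simp: mem_block_space)

lemma subspace_block_space: "vec.subspace (block_space A B C)"
  unfolding block_space_def
  by (intro vec_linear_subspace_image vec_linearI vec.subspace_UNIV)
    (simp_all add: blocks_add blocks_scale vector_matrix_left_distrib scalar_vector_matrix_assoc)

text \<open>An identity block makes the parametrization injective, so nonzero parameters give
  exactly the nonzero vectors.\<close>

lemma mat_space_eq_points_of:
  assumes "A = mat 1 \<or> B = mat 1 \<or> C = mat 1"
  shows "mat_space A B C = points_of (block_space A B C)"
proof -
  have "blocks (x v* A) (x v* B) (x v* C) = 0 \<longleftrightarrow> x = 0" for x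
    using assms by auto
  then show ?thesis by (fastforce simp: mat_space_def points_of_def block_space_def)
qed

lemma block_space_eq_iff:
  "block_space A B (mat 1) = block_space A' B' (mat 1) \<longleftrightarrow> A = A' \<and> B = B'"
  "block_space (mat 1) C 0 = block_space (mat 1) C' 0 \<longleftrightarrow> C = C'"
proof -
  show "block_space A B (mat 1) = block_space A' B' (mat 1) \<longleftrightarrow> A = A' \<and> B = B'"
  proof
    assume *: "block_space A B (mat 1) = block_space A' B' (mat 1)"
    have "blocks (x v* A) (x v* B) x \<in> block_space A' B' (mat 1)" for x
      unfolding *[symmetric] by simp
    then show "A = A' \<and> B = B'" by (auto intro!: matrix_eq_vector_matrix)
  qed simp
  show "block_space (mat 1) C 0 = block_space (mat 1) C' 0 \<longleftrightarrow> C = C'"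
  proof
    assume *: "block_space (mat 1) C 0 = block_space (mat 1) C' 0"
    have "blocks x (x v* C) 0 \<in> block_space (mat 1) C' 0" for x
      unfolding *[symmetric] by simp
    then show "C = C'" by (auto intro!: matrix_eq_vector_matrix)
  qed simp
qed

text \<open>The last hypothesis makes the third block a coordinate on \<open>W\<close>; taking it as
  the parameter turns the third matrix into the identity.\<close>

lemma block_space_third:
  fixes W :: "('a::{field,finite} ^ ('n::finite + 'n + 'n)) set"
  assumes "vec.subspace W" "vec.dim W = CARD('n)"
    and "\<And>w. w \<in> W \<Longrightarrow> block3 w = 0 \<Longrightarrow> w = 0"
  obtains A B where "W = block_space A B (mat 1)"
proof -
  obtain h where h: "vec_linear h" "range h = W" "\<And>x. block3 (h x) = x"
    using linear_section[OF assms(1,2) block_linear(3) assms(3)] by blast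
  obtain A B C where ABC: "\<And>x. h x = blocks (x v* A) (x v* B) (x v* C)"
    using linear_eq_blocks[OF h(1)] by metis
  have "x v* C = x" for x using h(3)[of x] ABC[of x] by simp
  then have "W = block_space A B (mat 1)" using h(2) ABC by (auto simp: block_space_def)
  then show ?thesis using that by blast
qed

lemma block_space_first:
  fixes W :: "('a::{field,finite} ^ ('n::finite + 'n + 'n)) set"
  assumes "vec.subspace W" "vec.dim W = CARD('n)"
    and "\<And>w. w \<in> W \<Longrightarrow> block1 w = 0 \<Longrightarrow> w = 0" "\<And>w. w \<in> W \<Longrightarrow> block3 w = 0"
  obtains C where "W = block_space (mat 1) C 0"
proof -
  obtain h where h: "vec_linear h" "range h = W" "\<And>x. block1 (h x) = x"
    using linear_section[OF assms(1,2) block_linear(1) assms(3)] by blast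
  obtain A B C where ABC: "\<And>x. h x = blocks (x v* A) (x v* B) (x v* C)"
    using linear_eq_blocks[OF h(1)] by metis
  have "x v* A = x" for x using h(3)[of x] ABC[of x] by simp
  moreover have "x v* C = 0" for x
  proof -
    have "block3 (h x) = 0" by (rule assms(4)) (simp flip: h(2))
    then show ?thesis by (simp add: ABC)
  qed
  ultimately have "W = block_space (mat 1) B 0" using h(2) ABC by (auto simp: block_space_def)
  then show ?thesis using that by blast
qed

text \<open>The working form of normality: a single nonzero vector of \<open>G\<close> in the sum of
  \<open>E\<close> and \<open>F\<close> pulls all of \<open>G\<close> into that sum. The explicit
  decomposition lets applications exhibit the two summands.\<close>

lemma vector_normal_subset:
  assumes "vector_spread d \<Omega>" "vector_normal \<Omega> E" "F \<in> \<Omega>" "F \<noteq> E" "G \<in> \<Omega>"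
    and "v \<in> G" "v \<noteq> 0" "v = e + f" "e \<in> E" "f \<in> F" and "w \<in> G"
  shows "\<exists>e\<in>E. \<exists>f\<in>F. w = e + f"
proof -
  have *: "vec.span (E \<union> F) = {e + f | e f. e \<in> E \<and> f \<in> F}"
    using assms vector_spread_subspace[OF assms(1)]
    by (intro span_Un_subspaces) (auto simp: vector_normal_def)
  then have "v \<in> vec.span (E \<union> F)" using assms by blast
  then have "G \<subseteq> vec.span (E \<union> F)" using assms unfolding vector_normal_def by blast
  then show ?thesis using * assms(11) by blast
qed

section \<open>The subspace of vanishing third block, the intended image of
  \<open>\<Pi>\<^sub>0\<close>\<close>

definition base_plane :: "('a::field ^ ('n::finite + 'n + 'n)) set" where
  "base_plane = {blocks x y 0 | x y. True}"

lemma blocks_in_base_plane [simp]: "blocks x y z \<in> base_plane \<longleftrightarrow> z = 0"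
  by (auto simp: base_plane_def)

lemma subspace_base_plane: "vec.subspace base_plane"
  unfolding vec.subspace_def by (auto simp: base_plane_def blocks_add blocks_scale)

lemma card_base_plane:
  "card (base_plane :: ('a::{field,finite} ^ ('n::finite + 'n + 'n)) set) = CARD('a ^ 'n) * CARD('a ^ 'n)"
proof -
  have "base_plane = (\<lambda>(x, y). blocks x y (0 :: 'a ^ 'n)) ` UNIV"
    by (auto simp: base_plane_def)
  moreover have "inj (\<lambda>(x, y). blocks x y (0 :: 'a ^ 'n))" by (auto intro: injI)
  ultimately have "card (base_plane :: ('a ^ ('n + 'n + 'n)) set) = CARD(('a ^ 'n) \<times> ('a ^ 'n))"
    by (metis card_image)
  then show ?thesis by (simp only: card_cartesian_product flip: UNIV_Times_UNIV)
qed

lemma infinity_neq: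
  fixes A B C :: "'a::field ^ 'n::finite ^ 'n"
  shows "block_space 0 (mat 1) 0 \<noteq> block_space (mat 1) C 0"
  "block_space 0 (mat 1) 0 \<noteq> block_space A B (mat 1)"
  "block_space (mat 1) C 0 \<noteq> block_space A B (mat 1)"
proof -
  obtain x :: "'a ^ 'n" where x: "x \<noteq> 0" using vec_nonzero_exists by blast
  have "blocks 0 x 0 \<in> block_space 0 (mat 1) 0" "blocks 0 x 0 \<notin> block_space (mat 1) C 0"
    "blocks 0 x 0 \<notin> block_space A B (mat 1)"
    "blocks x (x v* C) 0 \<in> block_space (mat 1) C 0"
    "blocks x (x v* C) 0 \<notin> block_space A B (mat 1)"
    using x by auto
  then show "block_space 0 (mat 1) 0 \<noteq> block_space (mat 1) C 0"
    "block_space 0 (mat 1) 0 \<noteq> block_space A B (mat 1)"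
    "block_space (mat 1) C 0 \<noteq> block_space A B (mat 1)" by blast+
qed

lemma block_space_subset_base_plane:
  fixes A B C :: "'a::field ^ 'n::finite ^ 'n"
  shows "block_space (mat 1) C 0 \<subseteq> base_plane" "block_space 0 (mat 1) 0 \<subseteq> base_plane"
  "\<not> block_space A B (mat 1) \<subseteq> base_plane"
proof -
  show "block_space (mat 1) C 0 \<subseteq> base_plane" "block_space 0 (mat 1) 0 \<subseteq> base_plane"
    by (auto simp: block_space_def)
  obtain x :: "'a ^ 'n" where x: "x \<noteq> 0" using vec_nonzero_exists by blast
  have "blocks (x v* A) (x v* B) x \<in> block_space A B (mat 1)" by simp
  moreover have "blocks (x v* A) (x v* B) x \<notin> base_plane" using x by simp
  ultimately show "\<not> block_space A B (mat 1) \<subseteq> base_plane" by blast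
qed

section \<open>Spreads in coordinates\<close>

text \<open>The normal form reached by a choice of coordinates. The last two assumptions put
  \<open>0\<close> into both coordinate sets of the affine elements and the identity into the
  first.\<close>

locale coordinatized_spread =
  fixes \<Omega> :: "('a::{field,finite} ^ ('n::finite + 'n + 'n)) set set"
  assumes spread: "vector_spread CARD('n) \<Omega>"
    and normal_inf: "vector_normal \<Omega> (block_space 0 (mat 1) 0)"
    and normal_0: "vector_normal \<Omega> (block_space (mat 1) 0 0)"
    and normal_1: "vector_normal \<Omega> (block_space (mat 1) (mat 1) 0)"
    and affine_0: "block_space 0 0 (mat 1) \<in> \<Omega>"
    and affine_1: "block_space (mat 1) 0 (mat 1) \<in> \<Omega>"
begin

definition M1 :: "('a ^ 'n ^ 'n) set" where
  "M1 = {A. \<exists>B. block_space A B (mat 1) \<in> \<Omega>}"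

definition M2 :: "('a ^ 'n ^ 'n) set" where
  "M2 = {B. \<exists>A. block_space A B (mat 1) \<in> \<Omega>}"

definition M0 :: "('a ^ 'n ^ 'n) set" where
  "M0 = {C. block_space (mat 1) C 0 \<in> \<Omega>}"

lemmas cover = vector_spread_cover[OF spread]
lemmas unique = vector_spread_unique[OF spread]
lemmas subspace = vector_spread_subspace[OF spread]

lemma dim_eq: "W \<in> \<Omega> \<Longrightarrow> vec.dim W = CARD('n)"
  using spread by (simp add: vector_spread_def)

lemma inf_in: "block_space 0 (mat 1) 0 \<in> \<Omega>"
  using normal_inf by (simp add: vector_normal_def)

lemma zero_in_M0: "0 \<in> M0" and one_in_M0: "mat 1 \<in> M0"
  using normal_0 normal_1 by (simp_all add: M0_def vector_normal_def)

lemma zero_in_M1: "0 \<in> M1" and zero_in_M2: "0 \<in> M2" and one_in_M1: "mat 1 \<in> M1"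
  using affine_0 affine_1 by (auto simp: M1_def M2_def)

text \<open>The vectors with third block zero form the sum of \<open>(0, I, 0)\<close> and
  \<open>(I, 0, 0)\<close>, so normality of the former keeps every element that meets this subspace
  nontrivially inside it.\<close>

lemma subset_base_plane:
  assumes "W \<in> \<Omega>" "blocks x y 0 \<in> W" "\<not> (x = 0 \<and> y = 0)" "v \<in> W"
  shows "block3 v = 0"
proof -
  have "\<exists>e\<in>block_space 0 (mat 1) 0. \<exists>f\<in>block_space (mat 1) 0 0. v = e + f"
  proof (rule vector_normal_subset[OF spread normal_inf])
    show "block_space (mat 1) 0 0 \<in> \<Omega>" using zero_in_M0 by (simp add: M0_def)
    show "block_space (mat 1) 0 0 \<noteq> block_space 0 (mat 1) 0" using infinity_neq(1) by metis
    show "blocks x y 0 = blocks 0 y 0 + blocks x 0 0" by (simp add: blocks_add)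
  qed (use assms in auto)
  then show ?thesis by (auto simp: block_space_def blocks_add)
qed

text \<open>The element through a vector with \<open>z \<noteq> 0\<close> meets
  \<open>base_plane\<close> trivially, so its third block can serve as parameter.\<close>

lemma affine_cover:
  assumes "z \<noteq> 0"
  obtains A B where "block_space A B (mat 1) \<in> \<Omega>" "x = z v* A" "y = z v* B"
proof -
  obtain W where W: "W \<in> \<Omega>" "blocks x y z \<in> W" using cover[of "blocks x y z"] assms by auto
  have "w = 0" if "w \<in> W" "block3 w = 0" for w
  proof (rule ccontr)
    assume "w \<noteq> 0"
    obtain a b where w: "w = blocks a b 0" using \<open>block3 w = 0\<close> blocks_collapse by metis
    then have "block3 (blocks x y z) = 0"
      using subset_base_plane[of W a b "blocks x y z"] W \<open>w \<in> W\<close> \<open>w \<noteq> 0\<close> by simp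
    then show False using assms by simp
  qed
  then obtain A B where "W = block_space A B (mat 1)"
    using block_space_third[OF subspace[OF W(1)] dim_eq[OF W(1)]] by blast
  then show ?thesis using that W by simp
qed

text \<open>The element through \<open>(x, y, 0)\<close> lies in \<open>base_plane\<close> and
  differs from \<open>(0, I, 0)\<close>, hence meets it trivially; its first block can then serve as
  parameter.\<close>

lemma plane_cover:
  assumes "x \<noteq> 0"
  obtains C where "C \<in> M0" "y = x v* C"
proof -
  obtain W where W: "W \<in> \<Omega>" "blocks x y 0 \<in> W" using cover[of "blocks x y 0"] assms by auto
  have third: "block3 w = 0" if "w \<in> W" for w
    using subset_base_plane[OF W _ that] assms by simp
  have ker: "w = 0" if "w \<in> W" "block1 w = 0" for w
  proof (rule ccontr)
    assume "w \<noteq> 0"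
    have "blocks 0 (block2 w) 0 = w" using that third blocks_collapse by metis
    then have "w \<in> block_space 0 (mat 1) 0" by (metis blocks_in_block_space(3))
    then have "W = block_space 0 (mat 1) 0"
      using unique[OF W(1) inf_in that(1)] \<open>w \<noteq> 0\<close> by blast
    then show False using W(2) assms by simp
  qed
  obtain C where "W = block_space (mat 1) C 0"
    by (rule block_space_first[OF subspace[OF W(1)] dim_eq[OF W(1)] ker third])
  then show ?thesis using that W by (simp add: M0_def)
qed

section \<open>Separation by normal elements and the count of affine elements\<close>

lemma M1_separated:
  assumes "A \<in> M1" "A' \<in> M1" "z v* A = z v* A'" "z \<noteq> 0"
  shows "A = A'"
proof (rule matrix_eq_vector_matrix)
  obtain B B' where B: "block_space A B (mat 1) \<in> \<Omega>" "block_space A' B' (mat 1) \<in> \<Omega>"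
    using assms by (auto simp: M1_def)
  fix w
  \<comment> \<open>The sum of \<open>(0, I, 0)\<close> and \<open>(A, B, I)\<close> consists of all
    \<open>(z A, y, z)\<close>. Agreement of \<open>A\<close> and \<open>A'\<close> at one
    \<open>z\<close> puts a vector of \<open>(A', B', I)\<close> into it, and normality then does so
    for every \<open>w\<close>.\<close>
  have "\<exists>e\<in>block_space 0 (mat 1) 0. \<exists>f\<in>block_space A B (mat 1).
      blocks (w v* A') (w v* B') w = e + f"
  proof (rule vector_normal_subset[OF spread normal_inf B(1) _ B(2)])
    show "block_space A B (mat 1) \<noteq> block_space 0 (mat 1) 0" using infinity_neq(2) by metis
    show "blocks (z v* A') (z v* B') z = blocks 0 (z v* B' - z v* B) 0 + blocks (z v* A) (z v* B) z"
      by (simp add: blocks_add assms)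
  qed (use assms in auto)
  then show "w v* A = w v* A'" by (auto simp: block_space_def blocks_add)
qed

text \<open>In the span of \<open>(I, C, 0)\<close> and \<open>(A, B, I)\<close> the expression \<open>y - x C\<close> equals \<open>z (B - A C)\<close>.\<close>

lemma shear_separated:
  assumes normal: "vector_normal \<Omega> (block_space (mat 1) C 0)"
    and B: "block_space A B (mat 1) \<in> \<Omega>" "block_space A' B' (mat 1) \<in> \<Omega>"
    and z: "z v* (B - A ** C) = z v* (B' - A' ** C)" "z \<noteq> 0"
  shows "B - A ** C = B' - A' ** C"
proof (rule matrix_eq_vector_matrix)
  fix w
  have "\<exists>e\<in>block_space (mat 1) C 0. \<exists>f\<in>block_space A B (mat 1).
      blocks (w v* A') (w v* B') w = e + f"
  proof (rule vector_normal_subset[OF spread normal B(1) _ B(2)])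
    show "block_space A B (mat 1) \<noteq> block_space (mat 1) C 0" using infinity_neq(3) by metis
    \<comment> \<open>The first block forces the summand from \<open>(I, C, 0)\<close> to have
      parameter \<open>?x\<close>; the assumption on \<open>z\<close> says that its second block
      fits as well.\<close>
    let ?x = "z v* A' - z v* A"
    have "?x v* C = z v* B' - z v* B" using z(1)
      by (simp add: vector_matrix_mult_diff_rdistrib vector_matrix_mult_diff_distrib
          vector_matrix_mul_assoc algebra_simps)
    then show "blocks (z v* A') (z v* B') z = blocks ?x (?x v* C) 0 + blocks (z v* A) (z v* B) z"
      by (simp add: blocks_add)
  qed (use z in auto)
  then obtain x where "w v* A' = x + w v* A" "w v* B' = x v* C + w v* B"
    by (auto simp: block_space_def blocks_add)
  then show "w v* (B - A ** C) = w v* (B' - A' ** C)"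
    by (simp add: vector_matrix_mult_diff_rdistrib flip: vector_matrix_mul_assoc)
      (simp add: vector_matrix_left_distrib)
qed

text \<open>This is the shear by \<open>C = 0\<close>, where \<open>B - A C\<close> is just
  \<open>B\<close>.\<close>

lemma M2_separated:
  assumes "B \<in> M2" "B' \<in> M2" "z v* B = z v* B'" "z \<noteq> 0"
  shows "B = B'"
proof -
  obtain A A' where "block_space A B (mat 1) \<in> \<Omega>" "block_space A' B' (mat 1) \<in> \<Omega>"
    using assms by (auto simp: M2_def)
  then have "B - A ** 0 = B' - A' ** 0"
    by (rule shear_separated[OF normal_0 _ _ _ assms(4)]) (use assms in simp)
  then show ?thesis by simp
qed

text \<open>There are \<open>q\<^sup>2\<^sup>n\<close> elements off the plane, as each of them meets the affine
  subspace \<open>z = z\<^sub>0\<close> in exactly one point.\<close>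

lemma affine_elements:
  "block_space A B (mat 1) \<in> \<Omega> \<longleftrightarrow> A \<in> M1 \<and> B \<in> M2" (is ?elements)
  and card_M1: "card M1 = CARD('a ^ 'n)" and card_M2: "card M2 = CARD('a ^ 'n)"
proof -
  let ?q = "CARD('a ^ 'n)"
  let ?P = "{(A, B). block_space A B (mat 1) \<in> \<Omega>}"
  obtain z :: "'a ^ 'n" where z: "z \<noteq> 0" using vec_nonzero_exists by blast
  have "(x, y) \<in> (\<lambda>(A, B). (z v* A, z v* B)) ` ?P" for x y
  proof -
    obtain A B where "block_space A B (mat 1) \<in> \<Omega>" "x = z v* A" "y = z v* B"
      using affine_cover[OF z] .
    then show ?thesis by (intro image_eqI[of _ _ "(A, B)"]) auto
  qed
  then have "(\<lambda>(A, B). (z v* A, z v* B)) ` ?P = UNIV" by auto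
  then have "CARD(('a ^ 'n) \<times> ('a ^ 'n)) \<le> card ?P" by (metis card_image_le finite)
  then have ge: "?q * ?q \<le> card ?P" by (simp flip: UNIV_Times_UNIV)
  have sub: "?P \<subseteq> M1 \<times> M2" by (auto simp: M1_def M2_def)
  then have le: "card ?P \<le> card M1 * card M2"
    using card_mono[OF _ sub] by (simp add: card_cartesian_product)
  have le1: "card M1 \<le> ?q" by (rule card_separated_le) (rule M1_separated)
  have le2: "card M2 \<le> ?q" by (rule card_separated_le) (rule M2_separated)
  have "?q > 0" by simp
  \<comment> \<open>The product of the two cardinalities is at least \<open>?q * ?q\<close> while
    each factor is at most \<open>?q\<close>, so both bounds are attained and every pair
    occurs.\<close>
  have "?q * ?q \<le> card M1 * ?q" using ge le le2 by (meson le_trans mult_le_mono2)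
  then show M1: "card M1 = ?q" using le1 \<open>?q > 0\<close> by simp
  have "?q * ?q \<le> ?q * card M2" using ge le le1 by (meson le_trans mult_le_mono1)
  then show M2: "card M2 = ?q" using le2 \<open>?q > 0\<close> by simp
  have "?P = M1 \<times> M2"
    using sub ge le M1 M2 by (intro card_subset_eq) (auto simp: card_cartesian_product)
  then show ?elements by blast
qed

text \<open>The set of all \<open>B - A C\<close> contains \<open>M2\<close> by taking
  \<open>A = 0\<close>, and separation bounds its size by that of \<open>M2\<close>, so the two
  coincide.\<close>

lemma shear_in_M2:
  assumes "vector_normal \<Omega> (block_space (mat 1) C 0)" "A \<in> M1" "B \<in> M2"
  shows "B - A ** C \<in> M2"
proof -
  let ?D = "(\<lambda>(A, B). B - A ** C) ` (M1 \<times> M2)"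
  have "M2 \<subseteq> ?D"
  proof
    fix B assume "B \<in> M2"
    then show "B \<in> ?D" using zero_in_M1 by (intro image_eqI[of _ _ "(0, B)"]) auto
  qed
  moreover have "card ?D \<le> card M2"
    unfolding card_M2
  proof (rule card_separated_le)
    fix X Y z assume "X \<in> ?D" "Y \<in> ?D" "z v* X = z v* Y" "z \<noteq> 0"
    \<comment> \<open>Every pair in \<open>M1 \<times> M2\<close> comes from a spread element, so
      \<open>shear_separated\<close> covers all of \<open>?D\<close>.\<close>
    then show "X = Y" using shear_separated[OF assms(1)] affine_elements by auto
  qed
  ultimately have "M2 = ?D" by (intro card_seteq) auto
  then show ?thesis using assms by auto
qed

lemma diff_in_M2: "A \<in> M1 \<Longrightarrow> B \<in> M2 \<Longrightarrow> B - A \<in> M2"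
  using shear_in_M2[OF normal_1] by simp

section \<open>The additive structure of \<open>M1\<close>\<close>

lemma M1_eq_M2: "M1 = M2"
proof (rule card_subset_eq)
  show "M1 \<subseteq> M2"
  proof
    fix A assume "A \<in> M1"
    \<comment> \<open>Subtracting \<open>A\<close> permutes the finite set \<open>M2\<close>. The
      preimage of \<open>0\<close> is \<open>A\<close>, which therefore lies in
      \<open>M2\<close>.\<close>
    then have "(\<lambda>B. B - A) ` M2 \<subseteq> M2" using diff_in_M2 by blast
    moreover have "card ((\<lambda>B. B - A) ` M2) = card M2" by (simp add: card_image inj_on_def)
    ultimately have "(\<lambda>B. B - A) ` M2 = M2" by (simp add: card_subset_eq)
    then show "A \<in> M2" using zero_in_M2 by (metis (no_types, lifting) eq_iff_diff_eq_0 imageE)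
  qed
qed (simp_all add: card_M1 card_M2)

lemma diff_in_M1: "A \<in> M1 \<Longrightarrow> B \<in> M1 \<Longrightarrow> B - A \<in> M1"
  using diff_in_M2 by (simp add: M1_eq_M2)

lemma uminus_in_M1: "A \<in> M1 \<Longrightarrow> - A \<in> M1"
  using diff_in_M1[of A 0] zero_in_M1 by simp

lemma semifield_M1: "semifield_spread_set M1"
proof -
  have "A + B \<in> M1" if "A \<in> M1" "B \<in> M1" for A B
    using diff_in_M1[OF uminus_in_M1[OF that(2)] that(1)] by simp
  moreover have "\<forall>A\<in>M1. \<forall>B\<in>M1. \<forall>x. x v* A = x v* B \<longrightarrow> x = 0 \<or> A = B"
    using M1_separated by blast
  ultimately show ?thesis
    by (simp add: semifield_spread_set_def spread_set_iff card_M1  zero_in_M1 one_in_M1)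
qed

section \<open>The spread induced on \<open>base_plane\<close> and the list of all elements\<close>

lemma M0_separated:
  assumes "C \<in> M0" "C' \<in> M0" "x v* C = x v* C'" "x \<noteq> 0"
  shows "C = C'"
  using unique[of "block_space (mat 1) C 0" "block_space (mat 1) C' 0" "blocks x (x v* C) 0"] assms
  by (simp add: M0_def block_space_eq_iff)

text \<open>Evaluation at a nonzero \<open>x\<close> is onto because the elements cover the vectors
  \<open>(x, y, 0)\<close>, and injective because distinct elements share no nonzero vector.\<close>

lemma spread_set_M0: "spread_set M0"
proof -
  obtain x :: "'a ^ 'n" where x: "x \<noteq> 0" using vec_nonzero_exists by blast
  have "y \<in> (\<lambda>C. x v* C) ` M0" for y using plane_cover[OF x] by (metis imageI)
  then have "(\<lambda>C. x v* C) ` M0 = UNIV" by auto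
  then have "CARD('a ^ 'n) \<le> card M0" by (metis card_image_le finite)
  moreover have "card M0 \<le> CARD('a ^ 'n)" by (rule card_separated_le) (rule M0_separated)
  ultimately show ?thesis using M0_separated by (auto simp: spread_set_iff )
qed

text \<open>One nonzero vector \<open>(x, y, z)\<close> determines the element containing it; the
  three shapes correspond to \<open>z \<noteq> 0\<close>, to \<open>z = 0\<close> with
  \<open>x \<noteq> 0\<close>, and to \<open>x = z = 0\<close>.\<close>

lemma element_cases:
  assumes "W \<in> \<Omega>"
  obtains (affine) A B where "A \<in> M1" "B \<in> M1" "W = block_space A B (mat 1)"
  | (plane) C where "C \<in> M0" "W = block_space (mat 1) C 0"
  | (infinity) "W = block_space 0 (mat 1) 0"
proof -
  obtain v where v: "v \<in> W" "v \<noteq> 0" using dim_pos_nonzero[of W] dim_eq[OF assms] by auto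
  obtain x y z where xyz: "v = blocks x y z" by (rule blocks_cases)
  show ?thesis
  proof (cases "z = 0")
    case False
    obtain A B where AB: "block_space A B (mat 1) \<in> \<Omega>" "x = z v* A" "y = z v* B"
      using affine_cover[OF False] .
    then have "W = block_space A B (mat 1)" using unique[OF assms AB(1) v(1)] v xyz by simp
    then show ?thesis using affine AB affine_elements M1_eq_M2 by blast
  next
    case z: True
    show ?thesis
    proof (cases "x = 0")
      case False
      obtain C where C: "C \<in> M0" "y = x v* C" using plane_cover[OF False] .
      then have "W = block_space (mat 1) C 0"
        using unique[OF assms _ v(1), of "block_space (mat 1) C 0"] v xyz z by (simp add: M0_def)
      then show ?thesis using plane C by blast
    next
      case True
      then have "W = block_space 0 (mat 1) 0" using unique[OF assms inf_in v(1)] v xyz z by simp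
      then show ?thesis by (rule infinity)
    qed
  qed
qed

lemma elements_eq:
  "\<Omega> = {block_space A B (mat 1) | A B. A \<in> M1 \<and> B \<in> M1} \<union>
     {block_space (mat 1) C 0 | C. C \<in> M0} \<union> {block_space 0 (mat 1) 0}"
    (is "_ = ?R")
proof
  show "\<Omega> \<subseteq> ?R"
  proof
    fix W assume "W \<in> \<Omega>"
    then show "W \<in> ?R" by (cases rule: element_cases) auto
  qed
  show "?R \<subseteq> \<Omega>" using affine_elements inf_in M1_eq_M2 by (auto simp: M0_def)
qed

section \<open>Normal elements and the right nucleus\<close>

lemma right_nucleus_if_normal:
  assumes normal: "vector_normal \<Omega> (block_space (mat 1) C 0)"
  shows "C \<in> right_nucleus M1"
proof (cases "C = 0")
  case False
  have C: "C \<in> M0" using normal by (simp add: M0_def vector_normal_def)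
  \<comment> \<open>The shear with \<open>B = 0\<close> gives \<open>- A C\<close>, and
    \<open>M1\<close> is closed under negation.\<close>
  have mem: "A ** C \<in> M1" if "A \<in> M1" for A
    using uminus_in_M1[of "0 - A ** C"] shear_in_M2[OF normal that zero_in_M2] by (simp add: M1_eq_M2)
  \<comment> \<open>Since \<open>C\<close> and \<open>0\<close> are distinct members of
    \<open>M0\<close>, \<open>C\<close> is nonsingular. Right multiplication by \<open>C\<close> is
    thus injective and, by finiteness, permutes \<open>M1\<close>.\<close>
  have "x = 0" if "x v* C = 0" for x
    using M0_separated[OF C zero_in_M0, of x] that False by auto
  then have "x = y" if "x v* C = y v* C" for x y
    using that vector_matrix_mult_diff_distrib[of x y C] by (metis eq_iff_diff_eq_0)
  then have "inj (\<lambda>A. A ** C)"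
    by (intro injI matrix_eq_vector_matrix) (metis vector_matrix_mul_assoc)
  then have "card ((\<lambda>A. A ** C) ` M1) = card M1" by (metis card_image inj_on_subset subset_UNIV)
  then have "(\<lambda>A. A ** C) ` M1 = M1" using mem by (intro card_subset_eq) auto
  moreover have "C \<in> M1" using mem[OF one_in_M1] by simp
  ultimately show ?thesis by (simp add: right_nucleus_def)
qed (simp add: right_nucleus_def zero_in_M1)

lemma span_plane_elements:
  assumes "E \<in> \<Omega>" "F \<in> \<Omega>" "E \<noteq> F" "E \<subseteq> base_plane" "F \<subseteq> base_plane"
  shows "vec.span (E \<union> F) = base_plane"
proof (rule span_Un_eqI)
  show "E \<inter> F \<subseteq> {0}" using unique assms by blast
  show "card (base_plane :: ('a ^ ('n + 'n + 'n)) set) = card E * card F"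
    using assms subspace dim_eq card_subspace by (metis card_base_plane)
qed (use assms subspace subspace_base_plane in auto)

text \<open>The sum of \<open>(I, C, 0)\<close> and \<open>(A, B, I)\<close> is given by
  \<open>y - x C = z (B - A C)\<close>. Closure of \<open>M1\<close> under right multiplication by
  \<open>C\<close> makes \<open>B - A C\<close> a member of \<open>M1\<close>, so two such matrices
  agreeing at a nonzero \<open>z\<close> are equal.\<close>

lemma normal_if_right_nucleus:
  assumes C: "C \<in> M0" "C \<in> right_nucleus M1"
  shows "vector_normal \<Omega> (block_space (mat 1) C 0)"
proof (cases "C = 0")
  case False
  then have mem: "A ** C \<in> M1" if "A \<in> M1" for A
    using C(2) that by (auto simp: right_nucleus_def)
  let ?E = "block_space (mat 1) C 0"
  have E: "?E \<in> \<Omega>" using C by (simp add: M0_def)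
  show ?thesis
    unfolding vector_normal_def
  proof (intro conjI ballI disjCI)
    show "?E \<in> \<Omega>" by fact
    fix F G assume F: "F \<in> \<Omega> - {?E}" and G: "G \<in> \<Omega>" and "\<not> G \<subseteq> vec.span (?E \<union> F)"
    show "G \<inter> vec.span (?E \<union> F) \<subseteq> {0}"
    proof (rule ccontr)
      assume "\<not> ?thesis"
      then obtain v where v: "v \<in> G" "v \<in> vec.span (?E \<union> F)" "v \<noteq> 0" by auto
      have "G \<subseteq> vec.span (?E \<union> F)"
      proof (cases "F \<subseteq> base_plane")
        case True
        \<comment> \<open>Here the sum is all of \<open>base_plane\<close>. An affine element meets
          it only in zero, which \<open>v\<close> contradicts; the other elements lie
          inside.\<close>
        have eq: "vec.span (?E \<union> F) = base_plane"
          using F E True block_space_subset_base_plane(1) by (intro span_plane_elements) auto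
        show ?thesis
          using G
        proof (cases rule: element_cases)
          case (affine A B)
          then show ?thesis using v eq by (cases v rule: blocks_cases) auto
        qed (simp_all only: eq block_space_subset_base_plane)
      next
        case False
        then obtain A B where F_eq: "F = block_space A B (mat 1)" "A \<in> M1" "B \<in> M1"
          using F block_space_subset_base_plane by (metis DiffD1 element_cases)
        have F_sub: "vec.subspace F" using F subspace by blast
        have span: "vec.span (?E \<union> F) = {e + f | e f. e \<in> ?E \<and> f \<in> F}"
          by (rule span_Un_subspaces[OF subspace_block_space F_sub])
        obtain x z where xz: "v = blocks x (x v* C) 0 + blocks (z v* A) (z v* B) z"
          using v(2) unfolding span unfolding F_eq by (auto simp: block_space_def)
        show ?thesis
        proof (cases "z = 0")
          case True
          then have "v \<in> ?E" using xz by (simp add: blocks_add)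
          then have "G = ?E" using unique[OF G E v(1)] v by blast
          then show ?thesis by (auto intro: vec.span_base)
        next
          case z: False
          have "v \<notin> base_plane" using xz z by (simp add: blocks_add)
          then have "\<not> G \<subseteq> base_plane" using v by blast
          then obtain A' B' where G_eq: "G = block_space A' B' (mat 1)" "A' \<in> M1" "B' \<in> M1"
            using G block_space_subset_base_plane by (metis element_cases)
          have "x + z v* A = z v* A'" "x v* C + z v* B = z v* B'"
            using v(1) xz by (simp_all add: G_eq blocks_add)
          then have "z v* (B - A ** C) = z v* (B' - A' ** C)"
            by (simp add: vector_matrix_mult_diff_rdistrib flip: vector_matrix_mul_assoc)
              (metis add_diff_cancel_left vector_matrix_left_distrib add.commute add_diff_cancel_left')
          \<comment> \<open>Both sides belong to \<open>M1\<close>, so agreement at the nonzero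
            \<open>z\<close> suffices.\<close>
          then have eq: "B - A ** C = B' - A' ** C"
            using z F_eq G_eq by (intro M1_separated diff_in_M1 mem) auto
          have "w v* B' - w v* B = (w v* A' - w v* A) v* C" for w
            using arg_cong[OF eq, of "\<lambda>X. w v* X"]
            by (simp add: vector_matrix_mult_diff_rdistrib vector_matrix_mult_diff_distrib
                vector_matrix_mul_assoc algebra_simps)
          then have "blocks (w v* A') (w v* B') w =
              blocks (w v* A' - w v* A) ((w v* A' - w v* A) v* C) 0 + blocks (w v* A) (w v* B) w" for w
            by (simp add: blocks_add flip: \<open>\<And>w. w v* B' - w v* B = (w v* A' - w v* A) v* C\<close>)
          then have "blocks (w v* A') (w v* B') w \<in> vec.span (?E \<union> F)" for w
            unfolding span unfolding F_eq by (metis (mono_tags, lifting) blocks_in_block_space(1,2) mem_Collect_eq)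
          then show ?thesis unfolding G_eq by (auto simp: block_space_def)
        qed
      qed
      then show False using \<open>\<not> G \<subseteq> _\<close> by blast
    qed
  qed
qed (use normal_0 in simp)

lemma normal_elements_in_base_plane:
  "{E. vector_normal \<Omega> E \<and> E \<subseteq> base_plane} =
    {block_space (mat 1) C 0 | C. C \<in> M0 \<inter> right_nucleus M1} \<union> {block_space 0 (mat 1) 0}"
proof (intro subset_antisym subsetI)
  fix E assume "E \<in> {E. vector_normal \<Omega> E \<and> E \<subseteq> base_plane}"
  then have E: "vector_normal \<Omega> E" "E \<subseteq> base_plane" "E \<in> \<Omega>" by (auto simp: vector_normal_def)
  from E(3) show "E \<in> {block_space (mat 1) C 0 | C. C \<in> M0 \<inter> right_nucleus M1} \<union>
      {block_space 0 (mat 1) 0}"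
  proof (cases rule: element_cases)
    case (affine A B)
    then show ?thesis using E(2) block_space_subset_base_plane(3) by blast
  next
    case (plane C)
    then show ?thesis using E(1) right_nucleus_if_normal by blast
  qed simp
qed (use normal_if_right_nucleus normal_inf block_space_subset_base_plane in blast)

lemma points_of_elements: "points_of ` \<Omega> = T3 M1 M0"
  by (subst elements_eq) (auto simp: T3_def mat_space_eq_points_of)

lemma points_of_normal_elements:
  "points_of ` {E. vector_normal \<Omega> E \<and> E \<subseteq> base_plane} =
    {mat_space (mat 1) C 0 | C. C \<in> M0 \<inter> right_nucleus M1} \<union> {mat_space 0 (mat 1) 0}"
  unfolding normal_elements_in_base_plane by (auto simp: mat_space_eq_points_of)

end

section \<open>Choice of coordinates\<close>

text \<open>Parametrize \<open>E2\<close> by \<open>a\<close>, then \<open>E1\<close> by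
  \<open>b\<close> so that \<open>a + b\<close> parametrizes \<open>E3\<close>, and an element
  \<open>F0\<close> outside \<open>P\<close> by \<open>c\<close> so that \<open>a + c\<close>
  parametrizes a further element \<open>F1\<close>. The required map inverts
  \<open>(x, y, z) \<mapsto> a x + b y + c z\<close>.\<close>

lemma coordinatized_spread_exists:
  fixes \<Omega> :: "('a::{field,finite} ^ ('n::finite + 'n + 'n)) set set"
  assumes spread: "vector_spread CARD('n) \<Omega>"
    and P: "vec.subspace P" "vec.dim P = 2 * CARD('n)"
    and E1: "vector_normal \<Omega> E1" "E1 \<subseteq> P"
    and E2: "vector_normal \<Omega> E2" "E2 \<subseteq> P"
    and E3: "vector_normal \<Omega> E3" "E3 \<subseteq> P"
    and distinct: "E1 \<noteq> E2" "E1 \<noteq> E3" "E2 \<noteq> E3"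
  obtains L :: "'a ^ ('n + 'n + 'n) \<Rightarrow> 'a ^ ('n + 'n + 'n)"
    where "vec_linear L" "bij L" "L ` P = base_plane" "coordinatized_spread ((`) L ` \<Omega>)"
proof -
  note sub = vector_spread_subspace[OF spread] and cover = vector_spread_cover[OF spread]
  have card: "card W = CARD('a ^ 'n)" if "W \<in> \<Omega>" for W
    using spread that by (intro card_subspace) (auto simp: vector_spread_def)
  have triv: "U \<inter> W \<subseteq> {0}" if "U \<in> \<Omega>" "W \<in> \<Omega>" "U \<noteq> W" for U W
    using vector_spread_unique[OF spread that(1,2)] that(3) by blast
  have E: "E1 \<in> \<Omega>" "E2 \<in> \<Omega>" "E3 \<in> \<Omega>"
    using E1 E2 E3 by (auto simp: vector_normal_def)
  have "card P = CARD('a ^ ('n + 'n))"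
    using P by (intro card_subspace) simp_all
  then have card_P: "card P = CARD('a ^ 'n) * CARD('a ^ 'n)" by (simp add: power_add)
  have span_P: "vec.span (E2 \<union> E1) = P"
    using E sub triv distinct E1 E2 P card_P card by (intro span_Un_eqI) auto
  have "P \<noteq> UNIV"
  proof
    assume "P = UNIV"
    then have "2 * CARD('n) = CARD('n + 'n + 'n)" using P(2) vec_dim_card by metis
    then show False by simp
  qed
  then obtain v where v: "v \<notin> P" by blast
  then have "v \<noteq> 0" using vec.subspace_0[OF P(1)] by auto
  then obtain F0 where F0: "F0 \<in> \<Omega>" "v \<in> F0" using cover by blast
  \<comment> \<open>\<open>P\<close> is the sum of \<open>E1\<close> and \<open>E2\<close>, so
    normality of \<open>E1\<close> leaves these two possibilities; \<open>v\<close> excludes the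
    second.\<close>
  have "F0 \<inter> P \<subseteq> {0} \<or> F0 \<subseteq> P"
    using E1(1) E(2) F0(1) distinct(1) unfolding vector_normal_def span_P[symmetric] Un_commute[of E2 E1]
    by blast
  then have F0_triv: "F0 \<inter> P \<subseteq> {0}" using F0(2) v by blast
  have "vec.dim E2 > 0" using spread E(2) by (simp add: vector_spread_def)
  \<comment> \<open>Shifting \<open>v\<close> by \<open>e\<close> leads to the element
    \<open>F1\<close>. Normality of \<open>E2\<close> will place it in the sum of \<open>E2\<close>
    and \<open>F0\<close>, as \<open>graph_map\<close> requires.\<close>
  then obtain e where e: "e \<in> E2" "e \<noteq> 0" using dim_pos_nonzero by blast
  have ve: "v + e \<notin> P"
  proof
    assume "v + e \<in> P"
    then have "(v + e) - e \<in> P" using e E2 P(1) by (intro vec.subspace_diff) auto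
    then show False using v by simp
  qed
  then have "v + e \<noteq> 0" using vec.subspace_0[OF P(1)] by auto
  then obtain F1 where F1: "F1 \<in> \<Omega>" "v + e \<in> F1" using cover by blast
  have "F1 \<noteq> F0"
  proof
    assume "F1 = F0"
    then have "(v + e) - v \<in> F0" using F0 F1 sub by (intro vec.subspace_diff) auto
    then show False using F0_triv e E2(2) by auto
  qed
  have "F0 \<noteq> E2" "F1 \<noteq> E2" using F0 F1 v ve E2 by auto
  have "v + e \<in> vec.span (E2 \<union> F0)"
    using F0 e by (intro vec.span_add) (auto intro: vec.span_base)
  then have F1_sub: "F1 \<subseteq> vec.span (E2 \<union> F0)"
    using E2(1) F0(1) F1 \<open>F0 \<noteq> E2\<close> \<open>v + e \<noteq> 0\<close> unfolding vector_normal_def by blast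
  have "vec.dim E2 = CARD('n)" using spread E(2) by (simp add: vector_spread_def)
  then obtain a :: "'a ^ 'n \<Rightarrow> 'a ^ ('n + 'n + 'n)"
    where a: "vec_linear a" "inj a" "range a = E2"
    by (rule card_vec_subspace[OF sub[OF E(2)]])
  obtain b where b: "vec_linear b" "inj b" "range b = E1" "range (\<lambda>x. a x + b x) = E3"
    by (rule graph_map[OF a(1,2) sub[OF E(1)] card[OF E(1)] sub[OF E(3)] card[OF E(3)]])
      (use triv E distinct E3 span_P a in auto)
  obtain c where c: "vec_linear c" "inj c" "range c = F0" "range (\<lambda>x. a x + c x) = F1"
    by (rule graph_map[OF a(1,2) sub[OF F0(1)] card[OF F0(1)] sub[OF F1(1)] card[OF F1(1)]])
      (use triv E F0 F1 \<open>F1 \<noteq> F0\<close> \<open>F0 \<noteq> E2\<close> \<open>F1 \<noteq> E2\<close> F1_sub a in auto)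
  note lin = vec_linear_simps[OF a(1)] vec_linear_simps[OF b(1)] vec_linear_simps[OF c(1)]
    vec_linear_simps[OF block_linear(1)] vec_linear_simps[OF block_linear(2)]
    vec_linear_simps[OF block_linear(3)]
  define K where "K v = a (block1 v) + b (block2 v) + c (block3 v)" for v
  have K: "vec_linear K"
    by (rule vec_linearI) (simp_all add: K_def lin vec.scale_right_distrib algebra_simps)
  have K_blocks: "K (blocks x y z) = a x + b y + c z" for x y z by (simp add: K_def)
  \<comment> \<open>The sum is direct: \<open>F0\<close> meets \<open>P\<close>, the sum of
    \<open>E1\<close> and \<open>E2\<close>, trivially, and \<open>E1\<close> meets
    \<open>E2\<close> trivially.\<close>
  have ker: "u = 0" if "K u = 0" for u
  proof -
    obtain x y z where u: "u = blocks x y z" by (rule blocks_cases)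
    have "a x + b y + c z = 0" using that by (simp add: u K_blocks)
    then have "c z = - (a x + b y)" by (metis add.commute eq_neg_iff_add_eq_0)
    moreover have "- (a x + b y) \<in> P"
      using a(3) b(3) E1(2) E2(2) P(1)
      by (intro vec.subspace_neg vec.subspace_add) auto
    moreover have "c z \<in> F0" using c(3) by blast
    ultimately have "c z = 0" using F0_triv by (metis IntI singletonD subsetD)
    then have "z = 0" using c(2) lin by (metis injD)
    have "a x = - b y"
      using \<open>a x + b y + c z = 0\<close> \<open>c z = 0\<close> by (simp add: eq_neg_iff_add_eq_0)
    moreover have "- b y \<in> E1" using b(3) sub[OF E(1)] by (intro vec.subspace_neg) auto
    moreover have "a x \<in> E2" using a(3) by blast
    ultimately have "a x = 0"
      using triv[OF E(1,2) distinct(1)] by (metis IntI singletonD subsetD)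
    then have "x = 0" using a(2) lin by (metis injD)
    have "b y = 0" using \<open>a x = - b y\<close> \<open>a x = 0\<close> by simp
    then have "y = 0" using b(2) lin by (metis injD)
    show "u = 0" by (simp add: u \<open>x = 0\<close> \<open>y = 0\<close> \<open>z = 0\<close>)
  qed
  have "inj K"
  proof (rule injI)
    fix u w assume "K u = K w"
    then have "K (u - w) = 0" by (simp add: vec_linear_simps[OF K])
    then show "u = w" using ker[of "u - w"] by simp
  qed
  then have bij: "bij K" unfolding bij_def by (metis finite finite_UNIV_inj_surj)
  let ?L = "inv K"
  have L: "vec_linear ?L" "bij ?L" using vec_linear_inv[OF K bij] bij_imp_bij_inv[OF bij] .
  have L_image: "?L ` Y = X" if "K ` X = Y" for X Y
    using that \<open>inj K\<close> by (simp flip: that add: image_image)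
  have plane: "K ` base_plane = P"
  proof -
    have "K ` base_plane = {u + w | u w. u \<in> E2 \<and> w \<in> E1}" (is "_ = ?R")
    proof
      show "K ` base_plane \<subseteq> ?R"
      proof
        fix u assume "u \<in> K ` base_plane"
        then obtain x y where "u = a x + b y" by (auto simp: base_plane_def K_blocks lin)
        moreover have "a x \<in> E2" "b y \<in> E1" using a(3) b(3) by blast+
        ultimately show "u \<in> ?R" by blast
      qed
      show "?R \<subseteq> K ` base_plane"
      proof
        fix u assume "u \<in> ?R"
        then obtain x y where "u = K (blocks x y 0)"
          using a(3) b(3) by (auto simp: K_blocks lin)
        then show "u \<in> K ` base_plane" by simp
      qed
    qed
    then show ?thesis
      using span_P span_Un_subspaces[OF sub[OF E(2)] sub[OF E(1)]] by (simp only:)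
  qed
  have images: "K ` block_space 0 (mat 1) 0 = E1" "K ` block_space (mat 1) 0 0 = E2"
    "K ` block_space (mat 1) (mat 1) 0 = E3" "K ` block_space 0 0 (mat 1) = F0"
    "K ` block_space (mat 1) 0 (mat 1) = F1"
    using a(3) b(3,4) c(3,4) by (simp_all add: block_space_def image_image K_blocks lin)
  have "coordinatized_spread ((`) ?L ` \<Omega>)"
  proof
    show "vector_spread CARD('n) ((`) ?L ` \<Omega>)" by (rule vector_spread_image[OF L spread])
    show "vector_normal ((`) ?L ` \<Omega>) (block_space 0 (mat 1) 0)"
      using E1 vector_normal_image_iff[OF L] L_image[OF images(1)] by metis
    show "vector_normal ((`) ?L ` \<Omega>) (block_space (mat 1) 0 0)"
      using E2 vector_normal_image_iff[OF L] L_image[OF images(2)] by metis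
    show "vector_normal ((`) ?L ` \<Omega>) (block_space (mat 1) (mat 1) 0)"
      using E3 vector_normal_image_iff[OF L] L_image[OF images(3)] by metis
    show "block_space 0 0 (mat 1) \<in> (`) ?L ` \<Omega>"
      using F0 L_image[OF images(4)] by blast
    show "block_space (mat 1) 0 (mat 1) \<in> (`) ?L ` \<Omega>"
      using F1 L_image[OF images(5)] by blast
  qed
  then show ?thesis using that L L_image[OF plane] by blast
qed

section \<open>From coordinatized vector spreads back to projective space\<close>

theorem theorem5p9:
  fixes S :: "('a::{field,finite}, 'n::finite + 'n + 'n) pg_point set set"
    and \<Pi>\<^sub>0 :: "('a, 'n + 'n + 'n) pg_point set"
  assumes "odd CARD('a)"
    and "is_spread (CARD('n) - 1) S"
    and "proj_subspace (2 * CARD('n) - 1) \<Pi>\<^sub>0"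
    and "\<exists>E\<^sub>1 E\<^sub>2 E\<^sub>3. distinct [E\<^sub>1, E\<^sub>2, E\<^sub>3] \<and>
           (\<forall>E\<in>{E\<^sub>1, E\<^sub>2, E\<^sub>3}. normal_element S E \<and> E \<subseteq> \<Pi>\<^sub>0)"
  shows "\<exists>(M\<^sub>0 :: ('a ^ 'n ^ 'n) set) (M :: ('a ^ 'n ^ 'n) set) \<phi>.
           spread_set M\<^sub>0 \<and> 0 \<in> M\<^sub>0 \<and> mat 1 \<in> M\<^sub>0 \<and>
           semifield_spread_set M \<and>
           collineation \<phi> \<and>
           \<phi> ` \<Pi>\<^sub>0 = {proj_point (blocks x y 0) | x y. \<not> (x = 0 \<and> y = 0)} \<and>
           (\<lambda>E. \<phi> ` E) ` S = T3 M M\<^sub>0 \<and>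
           (\<lambda>E. \<phi> ` E) ` {E. normal_element S E \<and> E \<subseteq> \<Pi>\<^sub>0} =
             {mat_space (mat 1) C 0 | C. C \<in> M\<^sub>0 \<inter> right_nucleus M} \<union> {mat_space 0 (mat 1) 0}"
proof -
  \<comment> \<open>The subtractions do not truncate, as \<open>CARD('n)\<close> is
    positive.\<close>
  have n: "CARD('n) - 1 + 1 = CARD('n)" "2 * CARD('n) - 1 + 1 = 2 * CARD('n)" by simp_all
  obtain \<Omega> where spread: "vector_spread CARD('n) \<Omega>" and S: "S = points_of ` \<Omega>"
    using is_spread_imp_vector_spread[OF assms(2)] unfolding n by blast
  obtain P where P: "vec.subspace P" "vec.dim P = 2 * CARD('n)" "\<Pi>\<^sub>0 = points_of P"
    using assms(3) unfolding proj_subspace_def n by blast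
  note sub = vector_spread_subspace[OF spread]
  have normal: "{E. normal_element S E \<and> E \<subseteq> \<Pi>\<^sub>0} = points_of ` {W. vector_normal \<Omega> W \<and> W \<subseteq> P}"
  proof -
    have iff: "normal_element S E \<longleftrightarrow> (\<exists>W. vector_normal \<Omega> W \<and> E = points_of W)" for E
    proof -
      have "normal_element S E \<Longrightarrow> E \<in> points_of ` \<Omega>" by (simp add: normal_element_def S)
      moreover have "vector_normal \<Omega> W \<Longrightarrow> W \<in> \<Omega>" for W by (simp add: vector_normal_def)
      ultimately show ?thesis
        using normal_element_points_of_iff[OF spread zero_less_card_finite] unfolding S by blast
    qed
    have subset: "points_of W \<subseteq> \<Pi>\<^sub>0 \<longleftrightarrow> W \<subseteq> P" if "vector_normal \<Omega> W" for W
      using that sub P points_of_subset_iff by (metis vector_normal_def)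
    show ?thesis
    proof (intro subset_antisym subsetI)
      fix E assume "E \<in> points_of ` {W. vector_normal \<Omega> W \<and> W \<subseteq> P}"
      then obtain W where "E = points_of W" "vector_normal \<Omega> W" "W \<subseteq> P" by blast
      then show "E \<in> {E. normal_element S E \<and> E \<subseteq> \<Pi>\<^sub>0}" using iff[of E] subset[of W] by blast
    qed (use iff subset in auto)
  qed
  obtain E1 E2 E3 where E: "distinct [E1, E2, E3]"
      "{E1, E2, E3} \<subseteq> points_of ` {W. vector_normal \<Omega> W \<and> W \<subseteq> P}"
    using assms(4) unfolding normal[symmetric] by blast
  obtain W1 where W1: "E1 = points_of W1" "vector_normal \<Omega> W1" "W1 \<subseteq> P"
    using E(2) by blast
  obtain W2 where W2: "E2 = points_of W2" "vector_normal \<Omega> W2" "W2 \<subseteq> P"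
    using E(2) by blast
  obtain W3 where W3: "E3 = points_of W3" "vector_normal \<Omega> W3" "W3 \<subseteq> P"
    using E(2) by blast
  have "W1 \<noteq> W2" "W1 \<noteq> W3" "W2 \<noteq> W3" using E(1) unfolding W1(1) W2(1) W3(1) by auto
  note W = this W1(2,3) W2(2,3) W3(2,3)
  obtain L :: "'a ^ ('n + 'n + 'n) \<Rightarrow> 'a ^ ('n + 'n + 'n)"
    where L: "vec_linear L" "bij L" and LP: "L ` P = base_plane"
    and coord: "coordinatized_spread ((`) L ` \<Omega>)"
    by (rule coordinatized_spread_exists[OF spread P(1,2) W(4-9) W(1-3)])
  interpret coordinatized_spread "(`) L ` \<Omega>" by fact
  have image: "(`) ((`) L) ` points_of ` X = points_of ` (`) L ` X" for X
    by (simp add: image_image image_points_of L bij_is_inj)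
  have "(`) L ` \<Pi>\<^sub>0 = {proj_point (blocks x y 0) | x y. \<not> (x = 0 \<and> y = 0)}"
  proof -
    have "(`) L ` \<Pi>\<^sub>0 = points_of base_plane"
      by (simp add: P(3) image_points_of L bij_is_inj LP)
    also have "\<dots> = {proj_point (blocks x y 0) | x y. \<not> (x = 0 \<and> y = 0)}"
      unfolding points_of_def base_plane_def using blocks_eq_0_iff by blast
    finally show ?thesis .
  qed
  moreover have "(\<lambda>E. (`) L ` E) ` S = T3 M1 M0"
    by (simp only: S image points_of_elements)
  moreover have "(\<lambda>E. (`) L ` E) ` {E. normal_element S E \<and> E \<subseteq> \<Pi>\<^sub>0} =
      {mat_space (mat 1) C 0 | C. C \<in> M0 \<inter> right_nucleus M1} \<union> {mat_space 0 (mat 1) 0}"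
  proof -
    \<comment> \<open>Elements of the transported spread are images of elements of
      \<open>\<Omega>\<close>, and \<open>L\<close> respects normality and inclusion both
      ways.\<close>
    have "(`) L ` {W. vector_normal \<Omega> W \<and> W \<subseteq> P} =
        {E. vector_normal ((`) L ` \<Omega>) E \<and> E \<subseteq> base_plane}"
    proof (intro subset_antisym subsetI)
      fix E assume "E \<in> {E. vector_normal ((`) L ` \<Omega>) E \<and> E \<subseteq> base_plane}"
      moreover from this obtain W where "E = L ` W" by (auto simp: vector_normal_def)
      ultimately show "E \<in> (`) L ` {W. vector_normal \<Omega> W \<and> W \<subseteq> P}"
        using L by (simp add: vector_normal_image_iff inj_image_subset_iff bij_is_inj flip: LP)
    qed (use L in \<open>auto simp: vector_normal_image_iff simp flip: LP\<close>)
    then show ?thesis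
      by (simp only: normal image points_of_normal_elements)
  qed
  \<comment> \<open>The witnesses are \<open>M0\<close>, \<open>M1\<close> and the map of points
    induced by \<open>L\<close>.\<close>
  ultimately show ?thesis
    using spread_set_M0 zero_in_M0 one_in_M0 semifield_M1 collineation_image[OF L] by blast
qed

end
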